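(* Let $X$ be a Banach space, let $t_0<t_1$ be real numbers, let $0<\alpha\le 1$ and let $n\in\mathbb{N}$. Then $$RL^{n+\alpha}([t_0,t_1];X)\subsetneq H^{n,\alpha}_{t_0}([t_0,t_1];X),$$ and the inclusion is continuous, i.e. there is $M>0$ with $\|f\|_{H^{n,\alpha}([t_0,t_1];X)}\le M\|f\|_{RL^{n+\alpha}([t_0,t_1];X)}$ for all $f\in RL^{n+\alpha}([t_0,t_1];X)$.
   Context: $\mathbb{N}=\{0,1,2,\ldots\}$. $[\gamma]$ denotes the smallest integer greater than or equal to $\gamma$. For $\gamma>0$, $J_{t_0,t}^{\gamma}f(t)=\frac{1}{\Gamma(\gamma)}\int_{t_0}^{t}(t-s)^{\gamma-1}f(s)\,ds$ (Bochner integral), $J_{t_0,t}^0f=f$, and the Riemann–Liouville fractional derivative is $D_{t_0,t}^{\gamma}f(t)=\frac{d^{[\gamma]}}{dt^{[\gamma]}}\big[J_{t_0,t}^{[\gamma]-\gamma}f(t)\big]$ in the weak sense. $C^k([t_0,t_1];X)$ has norm $\sum_{j=0}^k\sup_t\|f^{(j)}(t)\|_X$. For $\gamma>0$, $RL^{\gamma}([t_0,t_1];X)=\{f\in C^{[\gamma]-1}([t_0,t_1];X): D_{t_0,t}^{\gamma}f\in C^0([t_0,t_1];X)\}$ (the weak derivative exists and has a continuous representative), with norm $\|f\|_{RL^{\gamma}}=\|f\|_{C^{[\gamma]-1}}+\|D_{t_0,t}^{\gamma}f\|_{C^0}$. For $n\in\mathbb{N}$ and $\alpha\in(0,1]$,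 $H^{n,\alpha}([t_0,t_1];X)$ is the space of $n$-times continuously differentiable $f:[t_0,t_1]\to X$ such that $\|f^{(n)}(t)-f^{(n)}(s)\|_X\le M|t-s|^{\alpha}$ for all $t,s\in[t_0,t_1]$ and some $M>0$, with norm $\|f\|_{H^{n,\alpha}}=\|f\|_{C^n}+\sup_{t\neq s}\frac{\|f^{(n)}(t)-f^{(n)}(s)\|_X}{|t-s|^{\alpha}}$, and $H^{n,\alpha}_{t_0}([t_0,t_1];X)=\{f\in H^{n,\alpha}([t_0,t_1];X): f^{(i)}(t_0)=0,\ i=0,\ldots,n\}$.
   Formalization: X≠{0} is assumed (else no strictness). For α=1 the inclusion fails (nonzero constants are in RL^{n+1}), so there it is RL^{n+1}⊆H^{n,1}, and those f in RL^{n+1} with f^{(i)}(t0)=0, i≤n, form a proper subset of H^{n,1}_{t0}. *)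

theory Defs
  imports "HOL-Analysis.Analysis"
begin

section \<open>The Bochner integral in an arbitrary Banach space\<close>

text \<open>
  The library defines the Bochner integral only for second countable (i.e. separable) target
  spaces. The definitions below repeat the library's ones without that restriction. No further
  measurability hypothesis is needed: the approximation by simple functions makes \<open>f\<close> almost
  everywhere separably valued, and \<open>norm (f x - s i x)\<close> is measurable because \<open>f\<close> is Borel
  measurable and \<open>s i\<close> has finite range.
\<close>

definition has_bochner :: "'b measure \<Rightarrow> ('b \<Rightarrow> 'a::banach) \<Rightarrow> 'a \<Rightarrow> bool" where
  "has_bochner M f x \<longleftrightarrow>
     f \<in> borel_measurable M \<and>
     (\<exists>s. (\<forall>i. Bochner_Integration.simple_bochner_integrable M (s i)) \<and>
          (\<lambda>i::nat. \<integral>\<^sup>+y. norm (f y - s i y) \<partial>M) \<longlonglongrightarrow> 0 \<and>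
          (\<lambda>i. Bochner_Integration.simple_bochner_integral M (s i)) \<longlonglongrightarrow> x)"

definition bochner_integrable :: "'b measure \<Rightarrow> ('b \<Rightarrow> 'a::banach) \<Rightarrow> bool" where
  "bochner_integrable M f \<longleftrightarrow> (\<exists>x. has_bochner M f x)"

definition bochner_integral :: "'b measure \<Rightarrow> ('b \<Rightarrow> 'a::banach) \<Rightarrow> 'a" where
  "bochner_integral M f = (if bochner_integrable M f then THE x. has_bochner M f x else 0)"

lemma borel_norm_diff_simple:
  fixes f :: "'b \<Rightarrow> 'a::banach"
  assumes f: "f \<in> borel_measurable M" and s: "simple_function M s"
  shows "(\<lambda>x. norm (f x - s x)) \<in> borel_measurable M"
proof -
  have fin: "finite (s ` space M)" using s by (simp add: simple_function_def)
  have "(\<lambda>x. norm (f x - y)) \<in> borel_measurable M" for y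
    using measurable_compose[OF f, of "\<lambda>z. norm (z - y)" borel]
    by (simp add: borel_measurable_continuous_onI continuous_intros)
  moreover have "s -` {y} \<inter> space M \<in> sets M" for y
    using s by (rule simple_functionD)
  ultimately have m: "(\<lambda>x. \<Sum>y\<in>s ` space M. indicator (s -` {y} \<inter> space M) x * norm (f x - y)) \<in> borel_measurable M"
    by (intro borel_measurable_sum borel_measurable_times borel_measurable_indicator) auto
  have "(\<Sum>y\<in>s ` space M. indicator (s -` {y} \<inter> space M) x * norm (f x - y)) = norm (f x - s x)" if "x \<in> space M" for x
  proof -
    have "(\<Sum>y\<in>s ` space M. indicator (s -` {y} \<inter> space M) x * norm (f x - y)) = (\<Sum>y\<in>s ` space M. if y = s x then norm (f x - y) else 0)"
      using that by (intro sum.cong) (auto simp: indicator_def)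
    then show ?thesis using fin that by simp
  qed
  with m show ?thesis by (subst measurable_cong[OF sym]) auto
qed

lemma has_bochner_unique:
  fixes x y :: "'a::banach"
  assumes "has_bochner M f x" "has_bochner M f y" shows "x = y"
proof -
  from assms obtain s t where f: "f \<in> borel_measurable M"
    and s: "\<And>i. Bochner_Integration.simple_bochner_integrable M (s i)"
    "(\<lambda>i::nat. \<integral>\<^sup>+y. norm (f y - s i y) \<partial>M) \<longlonglongrightarrow> 0"
    "(\<lambda>i. Bochner_Integration.simple_bochner_integral M (s i)) \<longlonglongrightarrow> x"
    and t: "\<And>i. Bochner_Integration.simple_bochner_integrable M (t i)"
    "(\<lambda>i::nat. \<integral>\<^sup>+y. norm (f y - t i y) \<partial>M) \<longlonglongrightarrow> 0"
    "(\<lambda>i. Bochner_Integration.simple_bochner_integral M (t i)) \<longlonglongrightarrow> y"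
    unfolding has_bochner_def by blast
  let ?I = "Bochner_Integration.simple_bochner_integral M"
  have bound: "ennreal (norm (?I (s i) - ?I (t i))) \<le> (\<integral>\<^sup>+y. norm (f y - s i y) \<partial>M) + (\<integral>\<^sup>+y. norm (f y - t i y) \<partial>M)" for i
  proof -
    have "ennreal (norm (?I (s i) - ?I (t i))) = norm (?I (\<lambda>x. s i x - t i x))"
      using s t by (subst Bochner_Integration.simple_bochner_integral_diff) auto
    also have "\<dots> \<le> ?I (\<lambda>x. norm (s i x - t i x))"
      using Bochner_Integration.simple_bochner_integrable_compose2[of "(-)" M "s i" "t i"] s t
      by (auto intro!: Bochner_Integration.simple_bochner_integral_norm_bound)
    also have "\<dots> = (\<integral>\<^sup>+x. norm (s i x - t i x) \<partial>M)"
      using Bochner_Integration.simple_bochner_integrable_compose2[of "\<lambda>x y. norm (x - y)" M "s i" "t i"] s t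
      by (auto intro!: Bochner_Integration.simple_bochner_integral_eq_nn_integral)
    also have "\<dots> \<le> (\<integral>\<^sup>+x. ennreal (norm (f x - s i x)) + ennreal (norm (f x - t i x)) \<partial>M)"
      by (intro nn_integral_mono)
        (metis dual_order.refl norm_diff_triangle_le norm_minus_commute ennreal_leI ennreal_plus norm_ge_zero)
    also have "\<dots> = (\<integral>\<^sup>+y. norm (f y - s i y) \<partial>M) + (\<integral>\<^sup>+y. norm (f y - t i y) \<partial>M)"
      using s(1)[of i] t(1)[of i] f
      by (intro nn_integral_add measurable_compose[OF _ measurable_ennreal] borel_norm_diff_simple)
        (auto simp: Bochner_Integration.simple_bochner_integrable.simps)
    finally show ?thesis .
  qed
  have "(\<lambda>i. ennreal (norm (?I (s i) - ?I (t i)))) \<longlonglongrightarrow> ennreal 0"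
  proof (rule tendsto_sandwich)
    show "\<forall>\<^sub>F i in sequentially. 0 \<le> ennreal (norm (?I (s i) - ?I (t i)))" by simp
    show "(\<lambda>_. 0) \<longlonglongrightarrow> ennreal 0" by simp
    show "\<forall>\<^sub>F i in sequentially. ennreal (norm (?I (s i) - ?I (t i))) \<le> (\<integral>\<^sup>+y. norm (f y - s i y) \<partial>M) + (\<integral>\<^sup>+y. norm (f y - t i y) \<partial>M)"
      using bound by (intro always_eventually allI)
    show "(\<lambda>i. (\<integral>\<^sup>+y. norm (f y - s i y) \<partial>M) + (\<integral>\<^sup>+y. norm (f y - t i y) \<partial>M)) \<longlonglongrightarrow> ennreal 0"
      using tendsto_add[OF s(2) t(2)] by simp
  qed
  then have "(\<lambda>i. norm (?I (s i) - ?I (t i))) \<longlonglongrightarrow> 0"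
    by (simp flip: ennreal_0)
  moreover have "(\<lambda>i. norm (?I (s i) - ?I (t i))) \<longlonglongrightarrow> norm (x - y)"
    using s(3) t(3) by (intro tendsto_intros)
  ultimately have "norm (x - y) = 0" by (rule LIMSEQ_unique[rotated])
  then show ?thesis by simp
qed

lemma has_bochner_integral_eq_bochner:
  "has_bochner M f x \<Longrightarrow> bochner_integral M f = x"
  unfolding bochner_integral_def bochner_integrable_def
  by (auto intro!: the_equality intro: has_bochner_unique)

lemma has_bochner_eq_library:
  fixes f :: "'b \<Rightarrow> 'a::{banach, second_countable_topology}"
  shows "has_bochner M f x \<longleftrightarrow> has_bochner_integral M f x"
  unfolding has_bochner_def has_bochner_integral.simps by blast

lemma bochner_integral_eq_library:
  fixes f :: "'b \<Rightarrow> 'a::{banach, second_countable_topology}"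
  shows "bochner_integral M f = integral\<^sup>L M f"
  unfolding bochner_integral_def bochner_integrable_def lebesgue_integral_def
    has_bochner_eq_library ..


section \<open>Spaces of differentiable and Hoelder continuous functions on a compact interval\<close>

text \<open>
  Functions on \<open>[a, b]\<close> are represented by functions on \<open>real\<close> whose values outside \<open>[a, b]\<close> are
  irrelevant: membership in every space below, and every norm below, depends only on the
  values on \<open>[a, b]\<close>. Hence (strict) inclusions between the sets are exactly (strict) inclusions
  between the function spaces on \<open>[a, b]\<close>. Derivatives at the end points are one-sided.
\<close>

definition nderiv :: "real \<Rightarrow> real \<Rightarrow> nat \<Rightarrow> (real \<Rightarrow> 'a::banach) \<Rightarrow> real \<Rightarrow> 'a" where
  "nderiv a b k f = ((\<lambda>g t. vector_derivative g (at t within {a..b})) ^^ k) f"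

definition Ck_space :: "nat \<Rightarrow> real \<Rightarrow> real \<Rightarrow> (real \<Rightarrow> 'a::banach) set" where
  "Ck_space k a b =
     {f. (\<forall>j<k. nderiv a b j f differentiable_on {a..b}) \<and>
         continuous_on {a..b} (nderiv a b k f)}"

definition Ck_norm :: "nat \<Rightarrow> real \<Rightarrow> real \<Rightarrow> (real \<Rightarrow> 'a::banach) \<Rightarrow> real" where
  "Ck_norm k a b f = (\<Sum>j\<le>k. SUP t\<in>{a..b}. norm (nderiv a b j f t))"

definition Holder_space :: "nat \<Rightarrow> real \<Rightarrow> real \<Rightarrow> real \<Rightarrow> (real \<Rightarrow> 'a::banach) set" where
  "Holder_space n \<alpha> a b =
     {f \<in> Ck_space n a b.
        \<exists>M>0. \<forall>t\<in>{a..b}. \<forall>s\<in>{a..b}.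
          norm (nderiv a b n f t - nderiv a b n f s) \<le> M * \<bar>t - s\<bar> powr \<alpha>}"

definition Holder_norm :: "nat \<Rightarrow> real \<Rightarrow> real \<Rightarrow> real \<Rightarrow> (real \<Rightarrow> 'a::banach) \<Rightarrow> real" where
  "Holder_norm n \<alpha> a b f =
     Ck_norm n a b f +
     (SUP (t, s)\<in>{(t, s). t \<in> {a..b} \<and> s \<in> {a..b} \<and> t \<noteq> s}.
        norm (nderiv a b n f t - nderiv a b n f s) / \<bar>t - s\<bar> powr \<alpha>)"

definition Holder0_space :: "nat \<Rightarrow> real \<Rightarrow> real \<Rightarrow> real \<Rightarrow> (real \<Rightarrow> 'a::banach) set" where
  "Holder0_space n \<alpha> a b = {f \<in> Holder_space n \<alpha> a b. \<forall>i\<le>n. nderiv a b i f a = 0}"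


section \<open>Weak derivatives on an open interval\<close>

definition test_functions :: "real \<Rightarrow> real \<Rightarrow> (real \<Rightarrow> real) set" where
  "test_functions a b =
     {\<phi>. (\<forall>k. (deriv ^^ k) \<phi> differentiable_on UNIV) \<and> closure {t. \<phi> t \<noteq> 0} \<subseteq> {a<..<b}}"

definition locally_bochner_integrable :: "real \<Rightarrow> real \<Rightarrow> (real \<Rightarrow> 'a::banach) \<Rightarrow> bool" where
  "locally_bochner_integrable a b f \<longleftrightarrow>
     (\<forall>c d. a < c \<and> d < b \<longrightarrow> bochner_integrable (lebesgue_on {c..d}) f)"

definition has_weak_deriv ::
    "nat \<Rightarrow> real \<Rightarrow> real \<Rightarrow> (real \<Rightarrow> 'a::banach) \<Rightarrow> (real \<Rightarrow> 'a) \<Rightarrow> bool" where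
  "has_weak_deriv m a b h g \<longleftrightarrow>
     locally_bochner_integrable a b h \<and> locally_bochner_integrable a b g \<and>
     (\<forall>\<phi>\<in>test_functions a b.
        bochner_integral (lebesgue_on {a<..<b}) (\<lambda>t. (deriv ^^ m) \<phi> t *\<^sub>R h t) =
        (-1) ^ m *\<^sub>R bochner_integral (lebesgue_on {a<..<b}) (\<lambda>t. \<phi> t *\<^sub>R g t))"


section \<open>Riemann--Liouville fractional calculus\<close>

definition RL_integral :: "real \<Rightarrow> real \<Rightarrow> (real \<Rightarrow> 'a::banach) \<Rightarrow> real \<Rightarrow> 'a" where
  "RL_integral t0 \<gamma> f t =
     (if \<gamma> = 0 then f t
      else (1 / Gamma \<gamma>) *\<^sub>R
             bochner_integral (lebesgue_on {t0..t}) (\<lambda>s. (t - s) powr (\<gamma> - 1) *\<^sub>R f s))"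

definition is_RL_deriv ::
    "real \<Rightarrow> real \<Rightarrow> real \<Rightarrow> (real \<Rightarrow> 'a::banach) \<Rightarrow> (real \<Rightarrow> 'a) \<Rightarrow> bool" where
  "is_RL_deriv t0 t1 \<gamma> f g \<longleftrightarrow>
     has_weak_deriv (nat \<lceil>\<gamma>\<rceil>) t0 t1 (RL_integral t0 (of_int \<lceil>\<gamma>\<rceil> - \<gamma>) f) g"

text \<open>
  The continuous representative of the (almost everywhere unique) Riemann--Liouville
  derivative. If it exists, its values on \<open>[t0, t1]\<close> are uniquely determined.
\<close>

definition RL_deriv :: "real \<Rightarrow> real \<Rightarrow> real \<Rightarrow> (real \<Rightarrow> 'a::banach) \<Rightarrow> real \<Rightarrow> 'a" where
  "RL_deriv t0 t1 \<gamma> f = (SOME g. continuous_on {t0..t1} g \<and> is_RL_deriv t0 t1 \<gamma> f g)"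

definition RL_space :: "real \<Rightarrow> real \<Rightarrow> real \<Rightarrow> (real \<Rightarrow> 'a::banach) set" where
  "RL_space \<gamma> t0 t1 =
     {f \<in> Ck_space (nat \<lceil>\<gamma>\<rceil> - 1) t0 t1.
        \<exists>g. continuous_on {t0..t1} g \<and> is_RL_deriv t0 t1 \<gamma> f g}"

definition RL_norm :: "real \<Rightarrow> real \<Rightarrow> real \<Rightarrow> (real \<Rightarrow> 'a::banach) \<Rightarrow> real" where
  "RL_norm \<gamma> t0 t1 f =
     Ck_norm (nat \<lceil>\<gamma>\<rceil> - 1) t0 t1 f + Ck_norm 0 t0 t1 (RL_deriv t0 t1 \<gamma> f)"

end

theory Submission
  imports Defs
begin

text \<open>
  A Bochner integral over a bounded set is a Henstock--Kurzweil integral, because the gauge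
  definition only sees the real function \<open>norm (f - s i)\<close>; so one can work with the
  library's integral even in a non-separable space.

  Write \<open>J\<^sup>\<gamma>\<close> for the fractional integral. If \<open>g\<close> is the derivative of order \<open>n + \<alpha>\<close> of \<open>f\<close>, then
  by the du Bois-Reymond lemma \<open>J\<^sup>1\<^sup>-\<^sup>\<alpha> f\<close> is a classical \<open>(n + 1)\<close>-fold antiderivative of \<open>g\<close>.
  Applying \<open>J\<^sup>\<alpha>\<close> and the semigroup law gives \<open>J\<^sup>1 f\<close>, so \<open>f\<close> is \<open>J\<^sup>n\<^sup>+\<^sup>\<alpha> g\<close> plus multiples of
  \<open>(t - t0) powr (k + \<alpha> - 1)\<close>, which for \<open>\<alpha> < 1\<close> are not \<open>n\<close> times continuously differentiable
  and hence absent. So the \<open>n\<close>-th derivative of \<open>f\<close> is \<open>J\<^sup>\<alpha> g\<close> up to a constant, and \<open>J\<^sup>\<alpha>\<close> maps bounded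
  functions to \<open>\<alpha>\<close>-Hoelder functions. The inclusion is strict since for an interior point \<open>c\<close>
  the function \<open>max 0 (t - c) powr (n + \<alpha>)\<close> has a derivative of order \<open>n + \<alpha>\<close> that jumps at \<open>c\<close>.
\<close>

section \<open>Bochner and Henstock--Kurzweil integrals\<close>

text \<open>Two obstacles shape the argument. For \<alpha> = 1 the integral of order 1 - \<alpha> is
  the identity, so RL^(n+1) is C^(n+1) and contains nonzero constants: no initial value is forced to
  vanish, and the inclusion into \<open>Holder0_space\<close> fails unless vanishing is imposed. For
  \<alpha> < 1 it is forced, because every derivative of f up to order n has the form J^\<alpha> w
  with w continuous, and such a function is 0 at t0. This is why the two cases are kept apart down
  to the final statement.

  The semigroup law amounts to exchanging two integrals with singular kernels and values in a
  possibly nonseparable space. It is obtained by density instead: a continuous function is, off the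
  left end point, a uniform limit of combinations of indicators of half-lines (c, infinity), and the
  fractional integrals of these are truncated powers, computed by Euler's Beta integral. The same
  truncated powers, with c an interior point, are the functions that make the inclusion
  strict.\<close>

lemma simple_bochner_has_integral:
  fixes s :: "real \<Rightarrow> 'a::banach"
  assumes S: "S \<in> sets lebesgue"
    and s: "Bochner_Integration.simple_bochner_integrable (lebesgue_on S) s"
  shows "(s has_integral Bochner_Integration.simple_bochner_integral (lebesgue_on S) s) S"
proof -
  have sf: "simple_function (lebesgue_on S) s"
    and fin: "emeasure (lebesgue_on S) {y\<in>S. s y \<noteq> 0} \<noteq> \<infinity>"
    using s by (auto simp: Bochner_Integration.simple_bochner_integrable.simps)
  define A where "A y = {x\<in>S. s x = y}" for y
  have A_meas: "A y \<in> sets (lebesgue_on S)" for y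
  proof -
    have "A y = s -` {y} \<inter> space (lebesgue_on S)" by (auto simp: A_def)
    then show ?thesis using simple_functionD(2)[OF sf, of "{y}"] by simp
  qed
  have A: "((\<lambda>x. indicat_real (A y) x *\<^sub>R y) has_integral measure (lebesgue_on S) (A y) *\<^sub>R y) S" for y
  \<comment> \<open>The level set of 0 may have infinite measure; its term vanishes on both
    sides.\<close>
  proof (cases "y = 0")
    case False
    have sub: "A y \<subseteq> S" by (auto simp: A_def)
    have eq: "emeasure (lebesgue_on S) (A y) = emeasure lebesgue (A y)"
      "measure (lebesgue_on S) (A y) = measure lebesgue (A y)"
      using S sub by (auto intro!: emeasure_restrict_space measure_restrict_space)
    have sets: "A y \<in> sets lebesgue"
      using A_meas S by (simp add: sets_restrict_space_iff)
    have ne: "{y\<in>S. s y \<noteq> 0} \<in> sets (lebesgue_on S)"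
    proof -
      have "{y\<in>S. s y \<noteq> 0} = s -` (- {0}) \<inter> space (lebesgue_on S)" by auto
      then show ?thesis using simple_functionD(2)[OF sf, of "- {0}"] by simp
    qed
    have "emeasure (lebesgue_on S) (A y) \<le> emeasure (lebesgue_on S) {y\<in>S. s y \<noteq> 0}"
      using False ne by (intro emeasure_mono) (auto simp: A_def)
    then have "A y \<in> lmeasurable"
      using fin sets eq by (intro fmeasurableI) (auto simp: top.not_eq_extremum less_top order_le_less_trans)
    then have "(indicat_real (A y) has_integral measure lebesgue (A y)) UNIV"
      by (simp add: lmeasurable_iff_has_integral)
    moreover have "indicat_real (A y) = (\<lambda>x. if x \<in> S then indicat_real (A y) x else 0)"
      using sub by (auto simp: indicator_def fun_eq_iff)
    ultimately have "(indicat_real (A y) has_integral measure lebesgue (A y)) S"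
      by (metis has_integral_restrict_UNIV)
    then show ?thesis
      unfolding eq(2) by (rule has_integral_scaleR_left)
  qed simp
  have "finite (s ` S)" using sf by (simp add: simple_function_def)
  then have "((\<lambda>x. \<Sum>y\<in>s ` S. indicat_real (A y) x *\<^sub>R y) has_integral
      (\<Sum>y\<in>s ` S. measure (lebesgue_on S) (A y) *\<^sub>R y)) S"
    using A by (intro has_integral_sum) auto
  moreover have "(\<Sum>y\<in>s ` S. indicat_real (A y) x *\<^sub>R y) = s x" if "x \<in> S" for x
  proof -
    have "(\<Sum>y\<in>s ` S. indicat_real (A y) x *\<^sub>R y) = (\<Sum>y\<in>s ` S. if y = s x then y else 0)"
      using that by (intro sum.cong) (auto simp: A_def)
    then show ?thesis using \<open>finite (s ` S)\<close> that by simp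
  qed
  moreover have "Bochner_Integration.simple_bochner_integral (lebesgue_on S) s
      = (\<Sum>y\<in>s ` S. measure (lebesgue_on S) (A y) *\<^sub>R y)"
    by (simp add: Bochner_Integration.simple_bochner_integral_def A_def)
  ultimately show ?thesis
    by (metis (no_types, lifting) has_integral_cong)
qed

lemma has_bochner_has_integral:
  fixes f :: "real \<Rightarrow> 'a::banach"
  assumes S: "S \<in> sets lebesgue" "S \<subseteq> {a..b}"
    and f: "has_bochner (lebesgue_on S) f x"
  shows "(f has_integral x) S"
proof -
  let ?I = "Bochner_Integration.simple_bochner_integral (lebesgue_on S)"
  obtain s where fm: "f \<in> borel_measurable (lebesgue_on S)"
    and s: "\<And>i. Bochner_Integration.simple_bochner_integrable (lebesgue_on S) (s i)"
    and lim: "(\<lambda>i::nat. \<integral>\<^sup>+y. norm (f y - s i y) \<partial>(lebesgue_on S)) \<longlonglongrightarrow> 0"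
    and I: "(\<lambda>i. ?I (s i)) \<longlonglongrightarrow> x"
    using f unfolding has_bochner_def by blast
  \<comment> \<open>Extension by 0 allows tagged divisions of one compact interval even if S is not
    an interval.\<close>
  define F where "F = (\<lambda>t. if t \<in> S then f t else 0)"
  have "(F has_integral x) {a..b}"
    unfolding has_integral_real
  proof (intro allI impI)
    fix e :: real assume e: "e > 0"
    have "\<forall>\<^sub>F i in sequentially. (\<integral>\<^sup>+y. norm (f y - s i y) \<partial>(lebesgue_on S)) < ennreal (e/4)"
      using e by (intro order_tendstoD(2)[OF lim]) auto
    moreover have "\<forall>\<^sub>F i in sequentially. dist (?I (s i)) x < e/4"
      using e by (intro tendstoD[OF I]) auto
    ultimately obtain i where i: "(\<integral>\<^sup>+y. norm (f y - s i y) \<partial>(lebesgue_on S)) < ennreal (e/4)"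
      "dist (?I (s i)) x < e/4"
      using eventually_happens'[OF sequentially_bot eventually_conj] by blast
    define d where "d = (\<lambda>y. norm (f y - s i y))"
    have dm: "d \<in> borel_measurable (lebesgue_on S)"
      unfolding d_def using s[of i] fm
      by (intro borel_norm_diff_simple) (auto simp: Bochner_Integration.simple_bochner_integrable.simps)
    have d: "integrable (lebesgue_on S) d"
      using dm i(1) by (intro integrableI_bounded) (auto simp: d_def intro: order.strict_trans)
    have "ennreal (integral\<^sup>L (lebesgue_on S) d) < ennreal (e/4)"
      using i(1) d by (subst nn_integral_eq_integral[symmetric]) (auto simp: d_def)
    then have dI: "integral\<^sup>L (lebesgue_on S) d < e/4"
      using e by (simp add: ennreal_less_iff d_def)
    have d_int: "((\<lambda>t. if t \<in> S then d t else 0) has_integral integral\<^sup>L (lebesgue_on S) d) {a..b}"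
      using has_integral_integral_lebesgue_on[OF d S(1)] S(2) by simp
    have s_int: "((\<lambda>t. if t \<in> S then s i t else 0) has_integral ?I (s i)) {a..b}"
      using simple_bochner_has_integral[OF S(1) s] S(2) by simp
    obtain g1 where g1: "gauge g1" "\<And>\<D>. \<D> tagged_division_of {a..b} \<Longrightarrow> g1 fine \<D> \<Longrightarrow>
        norm ((\<Sum>(t,k)\<in>\<D>. Henstock_Kurzweil_Integration.content k *\<^sub>R (if t \<in> S then d t else 0)) - integral\<^sup>L (lebesgue_on S) d) < e/4"
      using d_int[unfolded has_integral_real, rule_format, of "e/4"] e by auto
    obtain g2 where g2: "gauge g2" "\<And>\<D>. \<D> tagged_division_of {a..b} \<Longrightarrow> g2 fine \<D> \<Longrightarrow>
        norm ((\<Sum>(t,k)\<in>\<D>. Henstock_Kurzweil_Integration.content k *\<^sub>R (if t \<in> S then s i t else 0)) - ?I (s i)) < e/4"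
      using s_int[unfolded has_integral_real, rule_format, of "e/4"] e by auto
    show "\<exists>\<gamma>. gauge \<gamma> \<and> (\<forall>\<D>. \<D> tagged_division_of {a..b} \<and> \<gamma> fine \<D> \<longrightarrow>
        norm ((\<Sum>(t,k)\<in>\<D>. Henstock_Kurzweil_Integration.content k *\<^sub>R F t) - x) < e)"
    proof (intro exI[of _ "\<lambda>t. g1 t \<inter> g2 t"] conjI allI impI)
      show "gauge (\<lambda>t. g1 t \<inter> g2 t)" using g1 g2 by (simp add: gauge_Int)
      fix \<D> assume "\<D> tagged_division_of {a..b} \<and> (\<lambda>t. g1 t \<inter> g2 t) fine \<D>"
      then have D: "\<D> tagged_division_of {a..b}" "g1 fine \<D>" "g2 fine \<D>"
        by (auto simp: fine_Int)
      let ?F = "\<Sum>(t,k)\<in>\<D>. Henstock_Kurzweil_Integration.content k *\<^sub>R F t"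
      let ?s = "\<Sum>(t,k)\<in>\<D>. Henstock_Kurzweil_Integration.content k *\<^sub>R (if t \<in> S then s i t else 0)"
      let ?d = "\<Sum>(t,k)\<in>\<D>. Henstock_Kurzweil_Integration.content k *\<^sub>R (if t \<in> S then d t else 0)"
      have "?F - ?s = (\<Sum>(t,k)\<in>\<D>. Henstock_Kurzweil_Integration.content k *\<^sub>R (F t - (if t \<in> S then s i t else 0)))"
        by (simp add: sum_subtractf[symmetric] case_prod_beta scaleR_diff_right)
      also have "norm \<dots> \<le> ?d"
        by (rule sum_norm_le) (auto simp: F_def d_def content_pos_le)
      finally have 1: "norm (?F - ?s) \<le> ?d" .
      have 2: "?d < e/2" using g1(2)[OF D(1,2)] dI by (simp add: real_norm_def) argo
      have 3: "norm (?s - ?I (s i)) < e/4" by (rule g2(2)[OF D(1,3)])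
      have "norm ((?F - ?s) + (?s - ?I (s i)) + (?I (s i) - x)) \<le> norm (?F - ?s) + norm (?s - ?I (s i)) + norm (?I (s i) - x)"
        by (rule norm_triangle_le add_right_mono norm_triangle_ineq)+
      then have "norm (?F - x) \<le> norm (?F - ?s) + norm (?s - ?I (s i)) + norm (?I (s i) - x)"
        by (simp only: diff_add_cancel add_diff_eq)
      with 1 2 3 i(2) show "norm (?F - x) < e"
        unfolding dist_norm by linarith
    qed
  qed
  then show ?thesis
    using S(2) by (simp add: F_def)
qed

text \<open>The step function is a sum of half-line indicators, not of indicators of disjoint
  intervals, because the fractional integral of one half-line indicator is a single truncated power.
  All half-lines are open on the left, so the approximation says nothing at the point a.\<close>

lemma step_approx:
  fixes u :: "real \<Rightarrow> 'a::real_normed_vector"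
  assumes u: "continuous_on {a..b} u" and ab: "a < b" and e: "e > 0"
  obtains N :: nat and c x where "\<And>i. i < N \<Longrightarrow> a \<le> c i \<and> c i < b"
    and "\<And>s. a < s \<Longrightarrow> s \<le> b \<Longrightarrow> norm (u s - (\<Sum>i<N. indicat_real {c i<..} s *\<^sub>R x i)) \<le> e"
proof -
  have "uniformly_continuous_on {a..b} u"
    using u by (simp add: compact_uniformly_continuous)
  then obtain d where d: "d > 0"
    "\<And>s t. s \<in> {a..b} \<Longrightarrow> t \<in> {a..b} \<Longrightarrow> dist t s < d \<Longrightarrow> dist (u t) (u s) < e"
    using e unfolding uniformly_continuous_on_def by metis
  obtain N where N: "N > 0" "(b - a) / d < real N"
    by (metis gr0I not_less of_nat_0_le_iff reals_Archimedean2 zero_less_iff_neq_zero ab d(1)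
        diff_gt_0_iff_gt divide_pos_pos of_nat_0 order_less_asym)
  define c where "c i = a + real i * (b - a) / N" for i
  \<comment> \<open>Increments of u along the grid, so that partial sums telescope to u (c
    k).\<close>
  define x where "x i = (if i = 0 then u a else u (c i) - u (c (i - 1)))" for i
  have sum_x: "(\<Sum>i<Suc k. x i) = u (c k)" for k
    by (induction k) (auto simp: x_def c_def)
  show thesis
  proof
    show "a \<le> c i \<and> c i < b" if "i < N" for i
    proof -
      have "real i * (b - a) < real N * (b - a)" using that ab by simp
      moreover have "0 \<le> real i * (b - a)" using ab by simp
      ultimately show ?thesis using ab N by (auto simp: c_def field_simps)
    qed
    fix s assume s: "a < s" "s \<le> b"
    define z where "z = (s - a) * N / (b - a)"
    have z: "0 < z" "z \<le> N" using s ab N by (auto simp: z_def field_simps)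
    \<comment> \<open>The last index with c k < s. The inequality is strict since the half-lines are
      open, hence the ceiling minus 1 and not the floor.\<close>
    define k where "k = nat (\<lceil>z\<rceil> - 1)"
    have k: "real k < z" "z \<le> real k + 1" "k < N"
      using z unfolding k_def by linarith+
    have iff: "c i < s \<longleftrightarrow> real i < z" for i
      using ab N by (auto simp: c_def z_def field_simps)
    have "(\<Sum>i<N. indicat_real {c i<..} s *\<^sub>R x i) = (\<Sum>i<N. if i < Suc k then x i else 0)"
    proof (intro sum.cong refl)
      fix i
      have "real i < z \<longleftrightarrow> i < Suc k" using k by linarith
      then show "indicat_real {c i<..} s *\<^sub>R x i = (if i < Suc k then x i else 0)"
        by (simp add: iff)
    qed
    also have "\<dots> = (\<Sum>i<Suc k. x i)"
      using k by (intro sum.mono_neutral_cong_right) auto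
    also have "\<dots> = u (c k)" by (rule sum_x)
    finally have eq: "(\<Sum>i<N. indicat_real {c i<..} s *\<^sub>R x i) = u (c k)" .
    have "c k < s" using k iff by simp
    moreover have "s \<le> c (Suc k)" using iff[of "Suc k"] k by (auto simp: not_less[symmetric])
    moreover have "c (Suc k) - c k < d"
    proof -
      have "c (Suc k) - c k = (b - a) / N" by (simp add: c_def diff_divide_distrib[symmetric]) (simp add: algebra_simps)
      also have "\<dots> < d" using N d(1) by (simp add: field_simps)
      finally show ?thesis .
    qed
    moreover have "a \<le> c k" using ab N by (simp add: c_def)
    ultimately have "dist (u s) (u (c k)) < e"
      using s by (intro d(2)) (auto simp: dist_real_def)
    then show "norm (u s - (\<Sum>i<N. indicat_real {c i<..} s *\<^sub>R x i)) \<le> e"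
      by (simp add: eq dist_norm)
  qed
qed

lemma simple_function_indicator_Ioi:
  assumes "sets borel \<subseteq> sets N" "space N = UNIV"
  shows "simple_function (restrict_space N S) (indicat_real {c::real<..})"
proof -
  have "indicat_real {c<..} \<in> borel_measurable (restrict_space N S)"
    using assms by (intro measurable_restrict_space1 borel_measurable_indicator) auto
  moreover have "finite (indicat_real {c<..} ` space (restrict_space N S))"
    by (rule finite_subset[of _ "{0,1}"]) (auto simp: indicator_def)
  ultimately show ?thesis by (simp add: simple_function_borel_measurable)
qed

lemma simple_function_approx:
  fixes u :: "real \<Rightarrow> 'a::banach"
  assumes u: "continuous_on {a..b} u" and ab: "a < b" and S: "S \<subseteq> {a..b}" and e: "e > 0"
  obtains v where "simple_function (lebesgue_on S) v" "\<And>s. s \<in> S \<Longrightarrow> norm (u s - v s) \<le> e"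
proof -
  obtain N :: nat and c x where c: "\<And>i. i < N \<Longrightarrow> a \<le> c i \<and> c i < b"
    and cx: "\<And>s. a < s \<Longrightarrow> s \<le> b \<Longrightarrow> norm (u s - (\<Sum>i<N. indicat_real {c i<..} s *\<^sub>R x i)) \<le> e"
    using step_approx[OF u ab e] by blast
  have sf: "simple_function (lebesgue_on S) (indicat_real {d<..})" for d
    by (rule simple_function_indicator_Ioi) auto
  \<comment> \<open>Inserts the value u a at the one point that \<open>step_approx\<close> misses;
    the test is phrased through an indicator so that v is a composition of simple functions.\<close>
  define v where "v s = (if indicat_real {a<..} s = 0 then u a else (\<Sum>i<N. indicat_real {c i<..} s *\<^sub>R x i))" for s
  have "simple_function (lebesgue_on S) v"
    unfolding v_def
    by (rule simple_function_compose2[OF sf, where h="\<lambda>y z. if y = 0 then u a else z"])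
      (intro simple_function_sum simple_function_compose1[OF sf])
  moreover have "norm (u s - v s) \<le> e" if "s \<in> S" for s
  proof (cases "s = a")
    case False
    then have "a < s" "s \<le> b" using that S by force+
    then show ?thesis using cx by (simp add: v_def)
  qed (use e in \<open>auto simp: v_def\<close>)
  ultimately show thesis using that by blast
qed

text \<open>Comparing two approximants through f makes their integrals Cauchy before any integral of
  f is known to exist.\<close>

lemma simple_bochner_integral_dist_le:
  fixes f :: "'b \<Rightarrow> 'a::banach"
  assumes f: "f \<in> borel_measurable M"
    and s: "Bochner_Integration.simple_bochner_integrable M s"
    and t: "Bochner_Integration.simple_bochner_integrable M t"
  shows "ennreal (norm (Bochner_Integration.simple_bochner_integral M s - Bochner_Integration.simple_bochner_integral M t))
    \<le> (\<integral>\<^sup>+y. norm (f y - s y) \<partial>M) + (\<integral>\<^sup>+y. norm (f y - t y) \<partial>M)"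
proof -
  let ?I = "Bochner_Integration.simple_bochner_integral M"
  have "ennreal (norm (?I s - ?I t)) = norm (?I (\<lambda>x. s x - t x))"
    using s t by (subst Bochner_Integration.simple_bochner_integral_diff) auto
  also have "\<dots> \<le> ?I (\<lambda>x. norm (s x - t x))"
    using Bochner_Integration.simple_bochner_integrable_compose2[of "(-)" M s t] s t
    by (auto intro!: Bochner_Integration.simple_bochner_integral_norm_bound)
  also have "\<dots> = (\<integral>\<^sup>+x. norm (s x - t x) \<partial>M)"
    using Bochner_Integration.simple_bochner_integrable_compose2[of "\<lambda>x y. norm (x - y)" M s t] s t
    by (auto intro!: Bochner_Integration.simple_bochner_integral_eq_nn_integral)
  also have "\<dots> \<le> (\<integral>\<^sup>+x. ennreal (norm (f x - s x)) + ennreal (norm (f x - t x)) \<partial>M)"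
    by (intro nn_integral_mono)
      (metis dual_order.refl norm_diff_triangle_le norm_minus_commute ennreal_leI ennreal_plus norm_ge_zero)
  also have "\<dots> = (\<integral>\<^sup>+y. norm (f y - s y) \<partial>M) + (\<integral>\<^sup>+y. norm (f y - t y) \<partial>M)"
    using s t f
    by (intro nn_integral_add measurable_compose[OF _ measurable_ennreal] borel_norm_diff_simple)
      (auto simp: Bochner_Integration.simple_bochner_integrable.simps)
  finally show ?thesis .
qed

text \<open>Real dominated convergence sends the L1 distance between f and s i to 0; then the
  integrals of the s i are Cauchy, and completeness supplies the value. f is Borel as a pointwise
  limit in a metric space, which is valid in nonseparable spaces too.\<close>

lemma has_bochner_dominated:
  fixes f :: "'b \<Rightarrow> 'a::banach"
  assumes s: "\<And>i. simple_function M (s i)" and fin: "emeasure M (space M) \<noteq> \<infinity>"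
    and lim: "\<And>y. y \<in> space M \<Longrightarrow> (\<lambda>i. s i y) \<longlonglongrightarrow> f y"
    and w: "integrable M w" "\<And>i y. y \<in> space M \<Longrightarrow> norm (f y - s i y) \<le> w y"
  shows "\<exists>x. has_bochner M f x"
proof -
  let ?I = "Bochner_Integration.simple_bochner_integral M"
  have f: "f \<in> borel_measurable M"
    using borel_measurable_LIMSEQ_metric[OF borel_measurable_simple_function[OF s] lim] by simp
  have si: "Bochner_Integration.simple_bochner_integrable M (s i)" for i
  proof -
    have "emeasure M {y\<in>space M. s i y \<noteq> 0} \<le> emeasure M (space M)"
      by (rule emeasure_mono) auto
    with fin s show ?thesis
      by (auto simp: Bochner_Integration.simple_bochner_integrable.simps top_unique)
  qed
  define E where "E i = (\<integral>\<^sup>+y. norm (f y - s i y) \<partial>M)" for i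
  have "(\<lambda>i. (\<integral>\<^sup>+y. norm (f y - s i y) \<partial>M)) \<longlonglongrightarrow> (\<integral>\<^sup>+y. 0 \<partial>M)"
  proof (rule nn_integral_dominated_convergence)
    show "(\<lambda>y. ennreal (norm (f y - s i y))) \<in> borel_measurable M" for i
      using borel_norm_diff_simple[OF f s] by measurable
    show "(\<lambda>y. ennreal (w y)) \<in> borel_measurable M" using w(1) by measurable
    show "AE y in M. ennreal (norm (f y - s i y)) \<le> ennreal (w y)" for i
      using w(2) by (auto intro!: AE_I2 ennreal_leI)
    have "(\<integral>\<^sup>+y. ennreal (w y) \<partial>M) \<le> (\<integral>\<^sup>+y. ennreal (norm (w y)) \<partial>M)"
      by (intro nn_integral_mono ennreal_leI) auto
    also have "\<dots> < \<infinity>" using w(1) by (simp add: integrable_iff_bounded)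
    finally show "(\<integral>\<^sup>+y. ennreal (w y) \<partial>M) < \<infinity>" .
    have "(\<lambda>i. norm (f y - s i y)) \<longlonglongrightarrow> 0" if "y \<in> space M" for y
      using tendsto_norm[OF tendsto_diff[OF tendsto_const lim[OF that]], of "f y"] by simp
    then have "(\<lambda>i. ennreal (norm (f y - s i y))) \<longlonglongrightarrow> ennreal 0" if "y \<in> space M" for y
      using that by (intro tendsto_ennrealI) auto
    then show "AE y in M. (\<lambda>i. ennreal (norm (f y - s i y))) \<longlonglongrightarrow> 0"
      by auto
  qed auto
  then have E: "E \<longlonglongrightarrow> 0" by (simp add: E_def[abs_def])
  have "Cauchy (\<lambda>i. ?I (s i))"
  proof (rule metric_CauchyI)
    fix e :: real assume e: "e > 0"
    then have "\<forall>\<^sub>F i in sequentially. E i < ennreal (e/2)"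
      by (intro order_tendstoD(2)[OF E]) auto
    then obtain n where n: "\<And>i. i \<ge> n \<Longrightarrow> E i < ennreal (e/2)"
      by (auto simp: eventually_sequentially)
    have "dist (?I (s i)) (?I (s j)) < e" if "i \<ge> n" "j \<ge> n" for i j
    proof -
      have "ennreal (norm (?I (s i) - ?I (s j))) \<le> E i + E j"
        unfolding E_def by (rule simple_bochner_integral_dist_le[OF f si si])
      also have "\<dots> < ennreal (e/2) + ennreal (e/2)"
        using n that by (intro add_strict_mono) auto
      also have "\<dots> = ennreal e" using e by (simp flip: ennreal_plus)
      finally show ?thesis using e by (simp add: dist_norm ennreal_less_iff)
    qed
    then show "\<exists>n. \<forall>i\<ge>n. \<forall>j\<ge>n. dist (?I (s i)) (?I (s j)) < e" by blast
  qed
  then obtain x where "(\<lambda>i. ?I (s i)) \<longlonglongrightarrow> x"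
    using Cauchy_convergent_iff convergent_def by blast
  with f si E show ?thesis
    unfolding has_bochner_def E_def by blast
qed

section \<open>Bochner integrability of an integrable kernel times a continuous function\<close>

lemma continuous_on_Icc_norm_bound:
  fixes u :: "real \<Rightarrow> 'a::real_normed_vector"
  assumes "continuous_on {a..b} u"
  obtains B where "\<And>s. s \<in> {a..b} \<Longrightarrow> norm (u s) \<le> B"
proof -
  have "bounded (u ` {a..b})"
    using assms by (intro compact_imp_bounded compact_continuous_image) auto
  then show thesis using that unfolding bounded_iff by blast
qed

text \<open>The kernel k may be singular, so it is approximated only pointwise, under the bound 2 *
  |k|, while u is approximated uniformly. The products are simple functions and dominated
  convergence applies.\<close>

lemma has_bochner_scaleR_continuous:
  fixes u :: "real \<Rightarrow> 'a::banach"
  assumes S: "S \<in> sets lebesgue" "S \<subseteq> {a..b}" and ab: "a < b"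
    and k: "integrable (lebesgue_on S) k" and u: "continuous_on {a..b} u"
  shows "\<exists>x. has_bochner (lebesgue_on S) (\<lambda>s. k s *\<^sub>R u s) x"
proof -
  obtain \<kappa> where \<kappa>: "\<And>i::nat. simple_function (lebesgue_on S) (\<kappa> i)"
    "\<And>y. y \<in> S \<Longrightarrow> (\<lambda>i. \<kappa> i y) \<longlonglongrightarrow> k y" "\<And>i y. y \<in> S \<Longrightarrow> \<bar>\<kappa> i y\<bar> \<le> 2 * \<bar>k y\<bar>"
    using borel_measurable_implies_sequence_metric[OF borel_measurable_integrable[OF k], of 0]
    by (auto simp: dist_real_def) blast
  have "\<exists>v. simple_function (lebesgue_on S) v \<and> (\<forall>s\<in>S. norm (u s - v s) \<le> 1 / Suc i)" for i
    using simple_function_approx[OF u ab S(2), of "1 / Suc i"] by (metis divide_pos_pos of_nat_0_less_iff zero_less_Suc zero_less_one)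
  then obtain v where v: "\<And>i. simple_function (lebesgue_on S) (v i)"
    "\<And>i s. s \<in> S \<Longrightarrow> norm (u s - v i s) \<le> 1 / Suc i"
    by metis
  have v_lim: "(\<lambda>i. v i s) \<longlonglongrightarrow> u s" if "s \<in> S" for s
  proof -
    have "(\<lambda>i. u s - v i s) \<longlonglongrightarrow> 0"
      by (rule Lim_null_comparison[OF _ LIMSEQ_inverse_real_of_nat])
        (use v(2)[OF that] in \<open>auto simp: field_simps\<close>)
    then show ?thesis
      using tendsto_diff[of "\<lambda>_. u s" "u s" sequentially] by fastforce
  qed
  obtain B where B: "\<And>s. s \<in> {a..b} \<Longrightarrow> norm (u s) \<le> B"
    using continuous_on_Icc_norm_bound[OF u] by blast
  have "B \<ge> 0" using order_trans[OF norm_ge_zero B[of a]] ab by simp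
  show ?thesis
  \<comment> \<open>The bound adds |k| * B for the limit and 2 * |k| * (B + 1) for the approximants,
    as \<open>v i\<close> is within 1 of u.\<close>
  proof (rule has_bochner_dominated[of "lebesgue_on S" "\<lambda>i s. \<kappa> i s *\<^sub>R v i s" "\<lambda>s. k s *\<^sub>R u s"
        "\<lambda>s. \<bar>k s\<bar> * (3 * B + 2)"])
    show "simple_function (lebesgue_on S) (\<lambda>s. \<kappa> i s *\<^sub>R v i s)" for i
      by (rule simple_function_compose2[OF \<kappa>(1) v(1), where h=scaleR])
    have "emeasure lebesgue S \<le> emeasure lebesgue {a..b}"
      using S by (intro emeasure_mono) auto
    also have "\<dots> < \<infinity>" using ab by simp
    finally show "emeasure (lebesgue_on S) (space (lebesgue_on S)) \<noteq> \<infinity>"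
      using S(1) by (simp add: emeasure_restrict_space)
    show "(\<lambda>i. \<kappa> i y *\<^sub>R v i y) \<longlonglongrightarrow> k y *\<^sub>R u y" if "y \<in> space (lebesgue_on S)" for y
      using that \<kappa>(2) v_lim by (intro tendsto_scaleR) auto
    show "integrable (lebesgue_on S) (\<lambda>s. \<bar>k s\<bar> * (3 * B + 2))"
      using k by simp
    show "norm (k y *\<^sub>R u y - \<kappa> i y *\<^sub>R v i y) \<le> \<bar>k y\<bar> * (3 * B + 2)"
      if "y \<in> space (lebesgue_on S)" for i y
    proof -
      have y: "y \<in> S" "y \<in> {a..b}" using that S by auto
      have "norm (v i y) \<le> norm (u y) + norm (u y - v i y)"
        by (metis norm_minus_commute norm_triangle_sub)
      also have "\<dots> \<le> B + 1 / Suc i" using B[OF y(2)] v(2)[OF y(1), of i] by linarith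
      also have "\<dots> \<le> B + 1" by simp
      finally have vB: "norm (v i y) \<le> B + 1" .
      have "norm (k y *\<^sub>R u y - \<kappa> i y *\<^sub>R v i y) \<le> \<bar>k y\<bar> * norm (u y) + \<bar>\<kappa> i y\<bar> * norm (v i y)"
        using norm_triangle_ineq4[of "k y *\<^sub>R u y" "\<kappa> i y *\<^sub>R v i y"] by simp
      also have "\<dots> \<le> \<bar>k y\<bar> * B + (2 * \<bar>k y\<bar>) * (B + 1)"
        using B[OF y(2)] vB \<kappa>(3)[OF y(1), of i] \<open>B \<ge> 0\<close> by (intro add_mono mult_mono) auto
      finally show ?thesis by (simp add: algebra_simps)
    qed
  qed
qed

lemma bochner_integral_scaleR_continuous:
  fixes u :: "real \<Rightarrow> 'a::banach"
  assumes S: "S \<in> sets lebesgue" "S \<subseteq> {a..b}" and ab: "a < b"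
    and k: "integrable (lebesgue_on S) k" and u: "continuous_on {a..b} u"
  shows "((\<lambda>s. k s *\<^sub>R u s) has_integral bochner_integral (lebesgue_on S) (\<lambda>s. k s *\<^sub>R u s)) S"
proof -
  obtain x where x: "has_bochner (lebesgue_on S) (\<lambda>s. k s *\<^sub>R u s) x"
    using has_bochner_scaleR_continuous[OF assms] by blast
  then show ?thesis
    using has_bochner_has_integral[OF S x] has_bochner_integral_eq_bochner[OF x] by simp
qed

section \<open>Weak derivatives\<close>

text \<open>A chain of derivatives that merely exists is easy to build for products and affine
  substitutions by induction on the order, with no formula for the iterated
  \<open>deriv\<close>.\<close>

primrec differentiable_times :: "nat \<Rightarrow> (real \<Rightarrow> real) \<Rightarrow> bool" where
  "differentiable_times 0 f = True"
| "differentiable_times (Suc k) f =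
     (\<exists>f'. (\<forall>x. (f has_real_derivative f' x) (at x)) \<and> differentiable_times k f')"

lemma differentiable_times_SucI:
  "(\<And>x. (f has_real_derivative f' x) (at x)) \<Longrightarrow> differentiable_times k f' \<Longrightarrow> differentiable_times (Suc k) f"
  by auto

lemma differentiable_times_Suc: "differentiable_times (Suc k) f \<Longrightarrow> differentiable_times k f"
proof (induction k arbitrary: f)
  case (Suc k)
  then show ?case by (metis differentiable_times.simps(2))
qed simp

lemma differentiable_times_const: "differentiable_times k (\<lambda>_. c)"
  by (induction k arbitrary: c) (auto intro!: exI[of _ "\<lambda>_. 0"])

lemma differentiable_times_add:
  "differentiable_times k f \<Longrightarrow> differentiable_times k g \<Longrightarrow> differentiable_times k (\<lambda>x. f x + g x)"
proof (induction k arbitrary: f g)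
  case (Suc k)
  from Suc.prems obtain f' g' where "\<forall>x. (f has_real_derivative f' x) (at x)" "differentiable_times k f'"
    "\<forall>x. (g has_real_derivative g' x) (at x)" "differentiable_times k g'" by auto
  then show ?case
    using Suc.IH by (auto intro!: exI[of _ "\<lambda>x. f' x + g' x"] derivative_eq_intros)
qed simp

lemma differentiable_times_mult:
  "differentiable_times k f \<Longrightarrow> differentiable_times k g \<Longrightarrow> differentiable_times k (\<lambda>x. f x * g x)"
proof (induction k arbitrary: f g)
  case (Suc k)
  have fg: "differentiable_times k f" "differentiable_times k g"
    using Suc.prems by (simp_all only: differentiable_times_Suc)
  from Suc.prems obtain f' g' where *: "\<And>x. (f has_real_derivative f' x) (at x)" "differentiable_times k f'"
    "\<And>x. (g has_real_derivative g' x) (at x)" "differentiable_times k g'" by auto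
  have "((\<lambda>x. f x * g x) has_real_derivative f' x * g x + f x * g' x) (at x)" for x
    by (auto intro!: derivative_eq_intros *)
  moreover have "differentiable_times k (\<lambda>x. f' x * g x + f x * g' x)"
    using Suc.IH fg * by (intro differentiable_times_add) auto
  ultimately show ?case by (rule differentiable_times_SucI)
qed simp

lemma differentiable_times_affine:
  "differentiable_times k f \<Longrightarrow> differentiable_times k (\<lambda>x. f (c * x + d))"
proof (induction k arbitrary: f)
  case (Suc k)
  from Suc.prems obtain f' where *: "\<And>x. (f has_real_derivative f' x) (at x)" "differentiable_times k f'"
    by auto
  have "((\<lambda>x. f (c * x + d)) has_real_derivative c * f' (c * x + d)) (at x)" for x
  proof -
    have "((\<lambda>x. c * x + d) has_real_derivative c) (at x)"
      by (auto intro!: derivative_eq_intros)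
    from DERIV_chain2[OF *(1) this] show ?thesis by (simp add: mult.commute)
  qed
  moreover have "differentiable_times k (\<lambda>x. c * f' (c * x + d))"
    using Suc.IH * by (intro differentiable_times_mult differentiable_times_const) auto
  ultimately show ?case by (rule differentiable_times_SucI)
qed simp

lemma iterated_deriv_of_chain:
  assumes "F 0 = \<phi>" "\<And>k x. (F k has_real_derivative F (Suc k) x) (at x)"
  shows "(deriv ^^ k) \<phi> = F k"
proof (induction k)
  case (Suc k)
  have "deriv (F k) = F (Suc k)" using DERIV_imp_deriv[OF assms(2)] by blast
  then show ?case using Suc by simp
qed (use assms in simp)

lemma differentiable_times_iterated_deriv:
  "differentiable_times (Suc k) f \<Longrightarrow> ((deriv ^^ k) f has_real_derivative (deriv ^^ Suc k) f x) (at x)"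
proof (induction k arbitrary: f)
  case 0
  then show ?case by (auto simp: DERIV_deriv_iff_real_differentiable real_differentiable_def)
next
  case (Suc k)
  then obtain f' where f': "\<And>x. (f has_real_derivative f' x) (at x)" "differentiable_times (Suc k) f'"
    by (metis differentiable_times.simps(2))
  then have "deriv f = f'" by (auto simp: DERIV_imp_deriv)
  then show ?case using Suc.IH[OF f'(2)] by (simp add: funpow_swap1)
qed

lemma poly_times_exp_minus_tendsto_0:
  "((\<lambda>x::real. poly p x * exp (- x)) \<longlongrightarrow> 0) at_top"
proof -
  have "((\<lambda>x. \<Sum>i\<le>degree p. coeff p i * (x ^ i / exp x)) \<longlongrightarrow> (\<Sum>i\<le>degree p. coeff p i * 0)) at_top"
    by (intro tendsto_sum tendsto_mult tendsto_const tendsto_power_div_exp_0)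
  then show ?thesis
    by (simp add: poly_altdef sum_distrib_right exp_minus divide_inverse mult.assoc)
qed

text \<open>The classical smooth function exp (-1/x) glued to 0, with a polynomial in 1/x as factor:
  this makes the family closed under differentiation.\<close>

definition flat_fun :: "real poly \<Rightarrow> real \<Rightarrow> real" where
  "flat_fun p x = (if x > 0 then poly p (1 / x) * exp (- (1 / x)) else 0)"

text \<open>With y = 1/x, the chain rule produces the factor y^2, which is
  \<open>[:0, 0, 1:]\<close>; the difference p - p' comes from the exponential and the polynomial
  factor.\<close>

lemma has_real_derivative_flat_fun:
  "(flat_fun p has_real_derivative flat_fun ([:0, 0, 1:] * (p - pderiv p)) x) (at x)"
proof -
  let ?q = "[:0, 0, 1:] * (p - pderiv p)"
  consider "x > 0" | "x < 0" | "x = 0" by linarith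
  then show ?thesis
  proof cases
    case 1
    have "((\<lambda>x. poly p (1 / x) * exp (- (1 / x))) has_real_derivative
        poly (pderiv p) (1 / x) * (- (1 / x^2)) * exp (- (1 / x)) + poly p (1 / x) * (exp (- (1 / x)) * (1 / x^2))) (at x)"
      using 1 by (auto intro!: derivative_eq_intros DERIV_chain2[OF poly_DERIV] simp: power2_eq_square)
    also have "poly (pderiv p) (1 / x) * (- (1 / x^2)) * exp (- (1 / x)) + poly p (1 / x) * (exp (- (1 / x)) * (1 / x^2))
        = flat_fun ?q x"
      using 1 by (simp add: flat_fun_def field_simps power2_eq_square)
    finally show ?thesis
      by (rule has_field_derivative_transform_within_open[of _ _ _ "{0<..}"]) (use 1 in \<open>auto simp: flat_fun_def\<close>)
  next
    case 2
    have "((\<lambda>x. 0) has_real_derivative 0) (at x)" by simp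
    then have "(flat_fun p has_real_derivative 0) (at x)"
      by (rule has_field_derivative_transform_within_open[of _ _ _ "{..<0}"]) (use 2 in \<open>auto simp: flat_fun_def\<close>)
    then show ?thesis using 2 by (simp add: flat_fun_def)
  next
    case 3
    have "((\<lambda>h. flat_fun p h / h) \<longlongrightarrow> 0) (at 0)"
    proof (rule filterlim_split_at_real)
      have "\<forall>\<^sub>F h in at_left 0. 0 = flat_fun p h / h"
        by (rule eventually_at_leftI[of "-1"]) (auto simp: flat_fun_def)
      then show "((\<lambda>h. flat_fun p h / h) \<longlongrightarrow> 0) (at_left 0)"
        by (rule tendsto_eventually[OF eventually_mono]) simp
      \<comment> \<open>Dividing by h multiplies the polynomial in 1/h by its variable, so the
        exponential still wins.\<close>
      have "((\<lambda>h. poly (pCons 0 p) (inverse h) * exp (- inverse h)) \<longlongrightarrow> 0) (at_right 0)"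
        by (rule filterlim_compose[OF poly_times_exp_minus_tendsto_0 filterlim_inverse_at_top_right])
      moreover have "\<forall>\<^sub>F h in at_right 0. poly (pCons 0 p) (inverse h) * exp (- inverse h) = flat_fun p h / h"
        by (rule eventually_at_rightI[of 0 1]) (auto simp: flat_fun_def field_simps)
      ultimately show "((\<lambda>h. flat_fun p h / h) \<longlongrightarrow> 0) (at_right 0)"
        by (rule Lim_transform_eventually)
    qed
    then show ?thesis using 3 by (simp add: DERIV_def flat_fun_def)
  qed
qed

lemma differentiable_times_flat_fun: "differentiable_times k (flat_fun p)"
  by (induction k arbitrary: p) (auto intro!: has_real_derivative_flat_fun exI)

section \<open>Test functions on an open interval\<close>

lemma test_function_deriv:
  "\<phi> \<in> test_functions a b \<Longrightarrow> ((deriv ^^ k) \<phi> has_real_derivative (deriv ^^ Suc k) \<phi> x) (at x)"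
  unfolding test_functions_def
  by (auto simp: differentiable_on_def DERIV_deriv_iff_real_differentiable)

lemma test_function_continuous:
  "\<phi> \<in> test_functions a b \<Longrightarrow> continuous_on S ((deriv ^^ k) \<phi>)"
  by (meson DERIV_isCont continuous_at_imp_continuous_on test_function_deriv)

lemma test_functionI:
  assumes "\<And>k x. ((deriv ^^ k) \<phi> has_real_derivative (deriv ^^ Suc k) \<phi> x) (at x)"
    and "a < c" "d < b" "\<And>t. t < c \<or> d < t \<Longrightarrow> \<phi> t = 0"
  shows "\<phi> \<in> test_functions a b"
proof -
  have "{t. \<phi> t \<noteq> 0} \<subseteq> {c..d}" using assms(4) by force
  then have "closure {t. \<phi> t \<noteq> 0} \<subseteq> {c..d}" by (simp add: closure_minimal)
  also have "\<dots> \<subseteq> {a<..<b}" using assms by auto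
  finally have "closure {t. \<phi> t \<noteq> 0} \<subseteq> {a<..<b}" .
  moreover have "(deriv ^^ k) \<phi> differentiable_on UNIV" for k
    using assms(1)[of k] by (auto simp: differentiable_on_def real_differentiable_def)
  ultimately show ?thesis by (simp add: test_functions_def)
qed

lemma test_functionE:
  assumes "\<phi> \<in> test_functions a b" "a < b"
  obtains c d where "a < c" "c < d" "d < b" "\<And>t. t < c \<or> d < t \<Longrightarrow> \<phi> t = 0"
proof -
  \<comment> \<open>The midpoint keeps K nonempty when \<phi> is identically 0.\<close>
  define K where "K = insert ((a + b) / 2) (closure {t. \<phi> t \<noteq> 0})"
  have sub: "closure {t. \<phi> t \<noteq> 0} \<subseteq> {a<..<b}" using assms by (simp add: test_functions_def)
  then have K: "K \<subseteq> {a<..<b}" using assms(2) by (auto simp: K_def)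
  then have "bounded K" by (rule bounded_subset[rotated]) simp
  moreover have "closed K" by (simp add: K_def closed_insert)
  ultimately have "compact K" by (simp add: compact_eq_bounded_closed)
  moreover have "K \<noteq> {}" by (simp add: K_def)
  ultimately obtain c d where c: "c \<in> K" "\<And>t. t \<in> K \<Longrightarrow> c \<le> t" and d: "d \<in> K" "\<And>t. t \<in> K \<Longrightarrow> t \<le> d"
    using compact_attains_inf compact_attains_sup by metis
  have zero: "\<phi> t = 0" if "t \<notin> K" for t
    using that closure_subset[of "{t. \<phi> t \<noteq> 0}"] by (auto simp: K_def)
  show thesis
  \<comment> \<open>Moving halfway towards a and b gives a nondegenerate interval even if K is a
    single point.\<close>
  proof (rule that[of "(a + c) / 2" "(d + b) / 2"])
    have cd: "a < c" "d < b" "c \<le> d" using c d K by auto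
    then show "a < (a + c) / 2" "(a + c) / 2 < (d + b) / 2" "(d + b) / 2 < b" by auto
    show "\<phi> t = 0" if "t < (a + c) / 2 \<or> (d + b) / 2 < t" for t
    proof (rule zero, rule notI)
      assume "t \<in> K"
      then have "c \<le> t" "t \<le> d" using c d by auto
      with cd that show False by (auto simp: field_simps)
    qed
  qed
qed

lemma bump_function_exists:
  assumes "a < c" "c < d" "d < b"
  obtains \<phi> where "\<phi> \<in> test_functions a b" "\<And>t. \<phi> t \<ge> 0" "\<And>t. t \<le> c \<or> d \<le> t \<Longrightarrow> \<phi> t = 0"
    "\<And>t. c < t \<Longrightarrow> t < d \<Longrightarrow> \<phi> t > 0"
proof
  \<comment> \<open>A flat function rising at c times a reflected one that dies at d, written in the
    affine form of \<open>differentiable_times_affine\<close>.\<close>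
  define \<phi> where "\<phi> = (\<lambda>t. flat_fun 1 (1 * t + (- c)) * flat_fun 1 ((- 1) * t + d))"
  have "differentiable_times k \<phi>" for k
    unfolding \<phi>_def by (intro differentiable_times_mult differentiable_times_affine differentiable_times_flat_fun)
  then show "\<phi> \<in> test_functions a b"
    by (intro test_functionI[of _ a c d b] differentiable_times_iterated_deriv)
      (use assms in \<open>auto simp: \<phi>_def flat_fun_def\<close>)
  show "\<phi> t \<ge> 0" "t \<le> c \<or> d \<le> t \<Longrightarrow> \<phi> t = 0" "c < t \<Longrightarrow> t < d \<Longrightarrow> \<phi> t > 0" for t
    by (auto simp: \<phi>_def flat_fun_def)
qed

text \<open>Used with r the quotient of two integrals, so that the difference has mean zero and is
  the derivative of a test function.\<close>

lemma test_function_diff_scaled: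
  assumes \<phi>: "\<phi> \<in> test_functions a b" and \<theta>: "\<theta> \<in> test_functions a b" and ab: "a < b"
  shows "(\<lambda>t. \<phi> t - r * \<theta> t) \<in> test_functions a b"
    and "(deriv ^^ k) (\<lambda>t. \<phi> t - r * \<theta> t) = (\<lambda>t. (deriv ^^ k) \<phi> t - r * (deriv ^^ k) \<theta> t)"
proof -
  define F where "F k = (\<lambda>t. (deriv ^^ k) \<phi> t - r * (deriv ^^ k) \<theta> t)" for k
  have F: "(F k has_real_derivative F (Suc k) x) (at x)" for k x
    unfolding F_def by (intro DERIV_diff DERIV_cmult test_function_deriv[OF \<phi>] test_function_deriv[OF \<theta>])
  have eq: "(deriv ^^ k) (\<lambda>t. \<phi> t - r * \<theta> t) = F k" for k
    by (rule iterated_deriv_of_chain[where F=F, OF _ F]) (simp add: F_def)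
  then show "(deriv ^^ k) (\<lambda>t. \<phi> t - r * \<theta> t) = (\<lambda>t. (deriv ^^ k) \<phi> t - r * (deriv ^^ k) \<theta> t)"
    by (simp add: F_def)
  obtain c d where cd: "a < c" "c < d" "d < b" "\<And>t. t < c \<or> d < t \<Longrightarrow> \<phi> t = 0"
    by (rule test_functionE[OF \<phi> ab]) blast
  obtain c' d' where cd': "a < c'" "c' < d'" "d' < b" "\<And>t. t < c' \<or> d' < t \<Longrightarrow> \<theta> t = 0"
    by (rule test_functionE[OF \<theta> ab]) blast
  show "(\<lambda>t. \<phi> t - r * \<theta> t) \<in> test_functions a b"
  proof (rule test_functionI[of _ a "min c c'" "max d d'" b])
    show "((deriv ^^ k) (\<lambda>t. \<phi> t - r * \<theta> t) has_real_derivative (deriv ^^ Suc k) (\<lambda>t. \<phi> t - r * \<theta> t) x) (at x)" for k x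
      unfolding eq by (rule F)
  qed (use cd cd' in auto)
qed

text \<open>The primitive that starts at a is 0 to the left of the support of \<phi>, and to its
  right it equals the total integral; mean zero is what keeps its support compact.\<close>

lemma test_function_antiderivative:
  assumes \<phi>: "\<phi> \<in> test_functions a b" and ab: "a < b" and int0: "integral {a..b} \<phi> = 0"
  obtains \<psi> where "\<psi> \<in> test_functions a b" "\<And>t. (\<psi> has_real_derivative \<phi> t) (at t)"
    "\<And>k. (deriv ^^ Suc k) \<psi> = (deriv ^^ k) \<phi>"
proof -
  obtain c d where cd: "a < c" "c < d" "d < b" "\<And>t. t < c \<or> d < t \<Longrightarrow> \<phi> t = 0"
    by (rule test_functionE[OF \<phi> ab]) blast
  define \<psi> where "\<psi> t = integral {a..t} \<phi>" for t
  have cont: "continuous_on S \<phi>" for S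
    using test_function_continuous[OF \<phi>, of S 0] by simp
  have int: "\<phi> integrable_on {x..y}" for x y
    by (intro integrable_continuous_interval cont)
  have left: "\<psi> t = 0" if "t < c" for t
  proof -
    have "integral {a..t} \<phi> = integral {a..t} (\<lambda>_. 0)"
      using that cd by (intro integral_cong) auto
    then show ?thesis by (simp add: \<psi>_def)
  qed
  have right: "\<psi> t = 0" if "d < t" for t
  proof -
    \<comment> \<open>A common right end for t and b: \<phi> vanishes beyond d, so the integrals up
      to t, b and m agree, whichever of t and b is larger.\<close>
    define m where "m = max t b"
    have z: "integral {s..m} \<phi> = 0" if "d < s" for s
    proof -
      have "integral {s..m} \<phi> = integral {s..m} (\<lambda>_. 0)"
        using that cd by (intro integral_cong) auto
      then show ?thesis by simp
    qed
    have "integral {a..s} \<phi> + integral {s..m} \<phi> = integral {a..m} \<phi>" if "d < s" "s \<le> m" for s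
      using that cd int by (intro Henstock_Kurzweil_Integration.integral_combine) auto
    from this[of t] this[of b] z[of t] z[of b] that cd int0 show ?thesis
      by (simp add: \<psi>_def m_def)
  qed
  have deriv: "(\<psi> has_real_derivative \<phi> t) (at t)" for t
  proof -
    consider "t < c" | "d < t" | "c \<le> t" "t \<le> d" by linarith
    then show ?thesis
    proof cases
      case 1
      have "((\<lambda>x. 0) has_real_derivative 0) (at t)" by simp
      then have "(\<psi> has_real_derivative 0) (at t)"
        by (rule has_field_derivative_transform_within_open[of _ _ _ "{..<c}"]) (use 1 left in auto)
      then show ?thesis using 1 cd by simp
    next
      case 2
      have "((\<lambda>x. 0) has_real_derivative 0) (at t)" by simp
      then have "(\<psi> has_real_derivative 0) (at t)"
        by (rule has_field_derivative_transform_within_open[of _ _ _ "{d<..}"]) (use 2 right in auto)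
      then show ?thesis using 2 cd by simp
    next
      case 3
      then have "t \<in> {a<..<b}" using cd by auto
      then have "(\<psi> has_vector_derivative \<phi> t) (at t within {a..b})"
        unfolding \<psi>_def by (intro integral_has_vector_derivative cont) auto
      moreover have "at t within {a..b} = at t"
        using \<open>t \<in> {a<..<b}\<close> by (simp add: at_within_Icc_at)
      ultimately show ?thesis by (simp add: has_real_derivative_iff_has_vector_derivative)
    qed
  qed
  \<comment> \<open>The derivatives of \<psi> are those of \<phi> shifted by one.\<close>
  define F where "F = case_nat \<psi> (\<lambda>k. (deriv ^^ k) \<phi>)"
  have F: "(F k has_real_derivative F (Suc k) x) (at x)" for k x
    using deriv test_function_deriv[OF \<phi>] by (auto simp: F_def split: nat.splits)
  have eq: "(deriv ^^ k) \<psi> = F k" for k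
    by (rule iterated_deriv_of_chain[where F=F, OF _ F]) (simp add: F_def)
  show thesis
  proof (rule that)
    show "\<psi> \<in> test_functions a b"
      by (rule test_functionI[of _ a c d b], unfold eq, rule F) (use cd left right in auto)
    show "(deriv ^^ Suc k) \<psi> = (deriv ^^ k) \<phi>" for k
      unfolding eq by (simp add: F_def)
  qed (rule deriv)
qed

text \<open>The values have no order, so positivity of the integrand is replaced by closeness: under
  a bump located where w differs from w t by at most norm (w t) / 2, the weighted mean of w cannot
  be 0. The end points follow by continuity.\<close>

lemma du_Bois_Reymond_0:
  fixes w :: "real \<Rightarrow> 'a::banach"
  assumes ab: "a < b" and w: "continuous_on {a..b} w"
    and zero: "\<And>\<phi>. \<phi> \<in> test_functions a b \<Longrightarrow> integral {a..b} (\<lambda>t. \<phi> t *\<^sub>R w t) = 0"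
    and t: "t \<in> {a..b}"
  shows "w t = 0"
proof -
  have inner: "w t = 0" if t: "t \<in> {a<..<b}" for t
  proof (rule ccontr)
    assume nz: "w t \<noteq> 0"
    have "isCont w t" using continuous_on_interior[OF w] t by simp
    then obtain \<delta> where \<delta>: "\<delta> > 0" "\<And>s. dist s t < \<delta> \<Longrightarrow> dist (w s) (w t) < norm (w t) / 2"
      using nz unfolding continuous_at_eps_delta by (metis half_gt_zero zero_less_norm_iff)
    define c where "c = max ((a + t) / 2) (t - \<delta>)"
    define d where "d = min ((b + t) / 2) (t + \<delta>)"
    have cd: "a < c" "c < t" "t < d" "d < b" "t - \<delta> \<le> c" "d \<le> t + \<delta>"
      using t \<delta>(1) by (auto simp: c_def d_def less_max_iff_disj min_less_iff_disj)
    obtain \<phi> where \<phi>: "\<phi> \<in> test_functions a b" "\<And>t. \<phi> t \<ge> 0" "\<And>t. t \<le> c \<or> d \<le> t \<Longrightarrow> \<phi> t = 0"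
      "\<And>t. c < t \<Longrightarrow> t < d \<Longrightarrow> \<phi> t > 0"
      using bump_function_exists[of a c d b] cd by auto
    have cont: "continuous_on {a..b} \<phi>" using test_function_continuous[OF \<phi>(1), of _ 0] by simp
    have pos: "integral {a..b} \<phi> > 0"
    proof -
      have "integral {a..b} \<phi> \<ge> 0"
        using \<phi>(2) cont by (intro integral_nonneg integrable_continuous_interval) auto
      moreover have "integral {a..b} \<phi> \<noteq> 0"
        using integral_eq_0_iff[OF cont ab] \<phi>(2) \<phi>(4)[OF cd(2,3)] t by force
      ultimately show ?thesis by simp
    qed
    \<comment> \<open>As the integral of \<phi> *R w is 0, the left side equals the integral of
      \<phi> times norm (w t), which is twice the right side.\<close>
    have "norm (integral {a..b} (\<lambda>s. \<phi> s *\<^sub>R (w s - w t))) \<le> integral {a..b} (\<lambda>s. \<phi> s * (norm (w t) / 2))"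
    proof (rule integral_norm_bound_integral)
      show "(\<lambda>s. \<phi> s *\<^sub>R (w s - w t)) integrable_on {a..b}" "(\<lambda>s. \<phi> s * (norm (w t) / 2)) integrable_on {a..b}"
        by (intro integrable_continuous_interval continuous_intros cont w)+
      fix s
      show "norm (\<phi> s *\<^sub>R (w s - w t)) \<le> \<phi> s * (norm (w t) / 2)"
      proof (cases "c < s \<and> s < d")
        case True
        then have "dist s t < \<delta>" using cd by (auto simp: dist_real_def)
        then show ?thesis using \<delta>(2)[of s] \<phi>(2)[of s] by (auto simp: dist_norm simp del: times_divide_eq_right intro!: mult_left_mono)
      qed (use \<phi>(3)[of s] in auto)
    qed
    moreover have "integral {a..b} (\<lambda>s. \<phi> s *\<^sub>R (w s - w t)) = - (integral {a..b} \<phi> *\<^sub>R w t)"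
    proof -
      have "integral {a..b} (\<lambda>s. \<phi> s *\<^sub>R w s - \<phi> s *\<^sub>R w t) = integral {a..b} (\<lambda>s. \<phi> s *\<^sub>R w s) - integral {a..b} (\<lambda>s. \<phi> s *\<^sub>R w t)"
        by (intro integral_diff integrable_continuous_interval continuous_intros cont w)
      also have "integral {a..b} (\<lambda>s. \<phi> s *\<^sub>R w t) = integral {a..b} \<phi> *\<^sub>R w t"
        using cont by (intro integral_unique has_integral_scaleR_left integrable_integral integrable_continuous_interval)
      finally show ?thesis using zero[OF \<phi>(1)] by (simp add: scaleR_diff_right)
    qed
    moreover have "integral {a..b} (\<lambda>s. \<phi> s * (norm (w t) / 2)) = integral {a..b} \<phi> * (norm (w t) / 2)"
      by (rule integral_mult_left)
    ultimately show False using pos nz by simp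
  qed
  have "{a..b} = closure {a<..<b}" using ab by simp
  then show ?thesis
    using continuous_constant_on_closure[of "{a<..<b}" w 0 t] w t inner by simp
qed

lemma integral_test_function_by_parts:
  fixes G :: "real \<Rightarrow> 'a::banach"
  assumes \<psi>: "\<psi> \<in> test_functions a b" and ab: "a < b" and g: "continuous_on {a..b} g"
    and G: "\<And>t. t \<in> {a..b} \<Longrightarrow> (G has_vector_derivative g t) (at t within {a..b})"
  shows "integral {a..b} (\<lambda>t. \<psi> t *\<^sub>R g t) = - integral {a..b} (\<lambda>t. deriv \<psi> t *\<^sub>R G t)"
proof -
  have Gc: "continuous_on {a..b} G"
    using G by (rule continuous_on_vector_derivative)
  have d: "(\<psi> has_real_derivative deriv \<psi> t) (at t within S)" for t S
    using test_function_deriv[OF \<psi>, of 0 t] by (simp add: has_field_derivative_at_within)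
  have c0: "continuous_on {a..b} \<psi>" "continuous_on {a..b} (deriv \<psi>)"
    using test_function_continuous[OF \<psi>, of _ 0] test_function_continuous[OF \<psi>, of _ 1] by auto
  have "((\<lambda>t. \<psi> t *\<^sub>R g t + deriv \<psi> t *\<^sub>R G t) has_integral \<psi> b *\<^sub>R G b - \<psi> a *\<^sub>R G a) {a..b}"
    using ab by (intro fundamental_theorem_of_calculus has_vector_derivative_scaleR d G) auto
  moreover have "\<psi> a = 0" "\<psi> b = 0"
    using test_functionE[OF \<psi> ab] by (metis order_less_trans)+
  ultimately have "integral {a..b} (\<lambda>t. \<psi> t *\<^sub>R g t + deriv \<psi> t *\<^sub>R G t) = 0"
    by (simp add: integral_unique)
  moreover have "integral {a..b} (\<lambda>t. \<psi> t *\<^sub>R g t + deriv \<psi> t *\<^sub>R G t)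
      = integral {a..b} (\<lambda>t. \<psi> t *\<^sub>R g t) + integral {a..b} (\<lambda>t. deriv \<psi> t *\<^sub>R G t)"
    by (intro Henstock_Kurzweil_Integration.integral_add integrable_continuous_interval continuous_intros c0 g Gc)
  ultimately show ?thesis by (simp add: eq_neg_iff_add_eq_0)
qed

text \<open>For a mean-zero test function, which is the derivative of another one, the identity of
  order m follows from the one of order m + 1 by parts, with any primitive of g. Every test function
  is a mean-zero one plus a multiple of the fixed bump \<beta>, so it remains to choose the constant
  of integration such that the identity holds for \<beta>.\<close>

lemma weak_derivative_lower_order:
  fixes h g :: "real \<Rightarrow> 'a::banach"
  assumes ab: "a < b" and h: "continuous_on {a..b} h" and g: "continuous_on {a..b} g"
    and weak: "\<And>\<phi>. \<phi> \<in> test_functions a b \<Longrightarrow>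
      integral {a..b} (\<lambda>t. (deriv ^^ Suc m) \<phi> t *\<^sub>R h t) = (-1) ^ Suc m *\<^sub>R integral {a..b} (\<lambda>t. \<phi> t *\<^sub>R g t)"
  obtains G where "\<And>t. t \<in> {a..b} \<Longrightarrow> (G has_vector_derivative g t) (at t within {a..b})"
    "\<And>\<phi>. \<phi> \<in> test_functions a b \<Longrightarrow>
      integral {a..b} (\<lambda>t. (deriv ^^ m) \<phi> t *\<^sub>R h t) = (-1) ^ m *\<^sub>R integral {a..b} (\<lambda>t. \<phi> t *\<^sub>R G t)"
proof -
  define G0 where "G0 t = integral {a..t} g" for t
  have G0: "(G0 has_vector_derivative g t) (at t within {a..b})" if "t \<in> {a..b}" for t
    unfolding G0_def using g that by (rule integral_has_vector_derivative)
  have G0c: "continuous_on {a..b} G0"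
    using G0 by (rule continuous_on_vector_derivative)
  define p where "p = (3 * a + b) / 4"
  define q where "q = (a + 3 * b) / 4"
  have pq: "a < p" "p < q" "q < b" using ab by (auto simp: p_def q_def)
  obtain \<beta> where \<beta>: "\<beta> \<in> test_functions a b" "\<And>t. \<beta> t \<ge> 0" "\<And>t. p < t \<Longrightarrow> t < q \<Longrightarrow> \<beta> t > 0"
    using bump_function_exists[OF pq] by metis
  have ti: "integral {a..b} \<beta> \<noteq> 0"
  proof -
    have cont: "continuous_on {a..b} \<beta>" using test_function_continuous[OF \<beta>(1), of _ 0] by simp
    obtain t where "p < t" "t < q" using pq dense by blast
    then show ?thesis
      using integral_eq_0_iff[OF cont ab] \<beta>(2) \<beta>(3)[of t] pq by force
  qed
  define J where "J = integral {a..b} \<beta>"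
  define C where "C = integral {a..b} (\<lambda>t. (deriv ^^ m) \<beta> t *\<^sub>R h t)"
  define D where "D = integral {a..b} (\<lambda>t. \<beta> t *\<^sub>R G0 t)"
  \<comment> \<open>Solves C = (-1)^m (D + J c), the identity of order m for \<beta>.\<close>
  define c where "c = (1 / J) *\<^sub>R ((-1) ^ m *\<^sub>R C - D)"
  define G where "G t = G0 t + c" for t
  have c0: "continuous_on {a..b} \<phi>" if "\<phi> \<in> test_functions a b" for \<phi>
    using test_function_continuous[OF that, of _ 0] by simp
  note cm = test_function_continuous[of _ a b "{a..b}"]
  show thesis
  proof (rule that)
    show "(G has_vector_derivative g t) (at t within {a..b})" if "t \<in> {a..b}" for t
      unfolding G_def using G0[OF that] by (auto intro!: derivative_eq_intros)
    fix \<phi> assume \<phi>: "\<phi> \<in> test_functions a b"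
    \<comment> \<open>The multiple of \<beta> that carries the whole mean of \<phi>.\<close>
    define r where "r = integral {a..b} \<phi> / J"
    define \<eta> where "\<eta> t = \<phi> t - r * \<beta> t" for t
    have \<eta>: "\<eta> \<in> test_functions a b" "(deriv ^^ k) \<eta> t = (deriv ^^ k) \<phi> t - r * (deriv ^^ k) \<beta> t" for k t
      using test_function_diff_scaled[OF \<phi> \<beta>(1) ab, where r=r] by (simp_all add: \<eta>_def[abs_def])
    have "integral {a..b} \<eta> = integral {a..b} \<phi> - r * J"
      unfolding \<eta>_def J_def
      by (subst integral_diff)
        (auto intro!: integrable_continuous_interval continuous_intros c0[OF \<phi>] c0[OF \<beta>(1)])
    then have "integral {a..b} \<eta> = 0" using ti by (simp add: r_def J_def)
    then obtain \<psi> where \<psi>: "\<psi> \<in> test_functions a b" "\<And>t. (\<psi> has_real_derivative \<eta> t) (at t)"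
      "\<And>k. (deriv ^^ Suc k) \<psi> = (deriv ^^ k) \<eta>"
      using test_function_antiderivative[OF \<eta>(1) ab] by blast
    have d\<psi>: "deriv \<psi> = \<eta>" using \<psi>(3)[of 0] by simp
    let ?A = "integral {a..b} (\<lambda>t. (deriv ^^ m) \<phi> t *\<^sub>R h t)"
    let ?B = "integral {a..b} (\<lambda>t. \<phi> t *\<^sub>R G0 t)"
    have "?A - r *\<^sub>R C = integral {a..b} (\<lambda>t. (deriv ^^ m) \<phi> t *\<^sub>R h t - r *\<^sub>R ((deriv ^^ m) \<beta> t *\<^sub>R h t))"
      unfolding C_def integral_cmul[symmetric]
      by (intro integral_diff[symmetric] integrable_continuous_interval continuous_intros cm \<phi> \<beta>(1) h)
    also have "\<dots> = integral {a..b} (\<lambda>t. (deriv ^^ Suc m) \<psi> t *\<^sub>R h t)"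
      unfolding \<psi>(3) \<eta>(2) by (simp add: scaleR_diff_left)
    also have "\<dots> = (-1) ^ Suc m *\<^sub>R integral {a..b} (\<lambda>t. \<psi> t *\<^sub>R g t)"
      by (rule weak[OF \<psi>(1)])
    also have "\<dots> = (-1) ^ m *\<^sub>R integral {a..b} (\<lambda>t. \<eta> t *\<^sub>R G0 t)"
      by (subst integral_test_function_by_parts[OF \<psi>(1) ab g G0]) (simp_all add: d\<psi>)
    also have "integral {a..b} (\<lambda>t. \<eta> t *\<^sub>R G0 t) = integral {a..b} (\<lambda>t. \<phi> t *\<^sub>R G0 t - r *\<^sub>R (\<beta> t *\<^sub>R G0 t))"
      by (simp add: \<eta>_def scaleR_diff_left)
    also have "\<dots> = ?B - r *\<^sub>R D"
      unfolding D_def integral_cmul[symmetric]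
      by (intro integral_diff integrable_continuous_interval continuous_intros c0 \<phi> \<beta>(1) G0c)
    finally have eq: "?A = r *\<^sub>R C + (-1) ^ m *\<^sub>R (?B - r *\<^sub>R D)" by (simp add: algebra_simps)
    have "integral {a..b} (\<lambda>t. \<phi> t *\<^sub>R G t) = integral {a..b} (\<lambda>t. \<phi> t *\<^sub>R G0 t + \<phi> t *\<^sub>R c)"
      by (simp add: G_def scaleR_add_right)
    also have "\<dots> = ?B + integral {a..b} (\<lambda>t. \<phi> t *\<^sub>R c)"
      by (intro Henstock_Kurzweil_Integration.integral_add integrable_continuous_interval continuous_intros c0 \<phi> G0c)
    also have "integral {a..b} (\<lambda>t. \<phi> t *\<^sub>R c) = integral {a..b} \<phi> *\<^sub>R c"
      by (intro integral_unique has_integral_scaleR_left integrable_integral integrable_continuous_interval c0 \<phi>)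
    also have "\<dots> = r *\<^sub>R ((-1) ^ m *\<^sub>R C - D)" by (simp add: c_def r_def)
    finally have G_eq: "integral {a..b} (\<lambda>t. \<phi> t *\<^sub>R G t) = ?B + r *\<^sub>R ((-1) ^ m *\<^sub>R C - D)" .
    have sq: "(-1) ^ m * (r * (-1) ^ m) = r"
      by (simp add: mult.left_commute flip: power_add mult_2)
    show "?A = (-1) ^ m *\<^sub>R integral {a..b} (\<lambda>t. \<phi> t *\<^sub>R G t)"
      unfolding eq G_eq scaleR_add_right scaleR_diff_right scaleR_scaleR sq by simp
  qed
qed

text \<open>Orders are peeled off at the top: g is replaced by a primitive that is a weak derivative
  of order one less, until at order 0 the two continuous functions h and g are equal by the du
  Bois-Reymond lemma.\<close>

lemma weak_derivative_classical:
  fixes h g :: "real \<Rightarrow> 'a::banach"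
  assumes ab: "a < b" and h: "continuous_on {a..b} h" and g: "continuous_on {a..b} g"
    and weak: "\<And>\<phi>. \<phi> \<in> test_functions a b \<Longrightarrow>
      integral {a..b} (\<lambda>t. (deriv ^^ m) \<phi> t *\<^sub>R h t) = (-1) ^ m *\<^sub>R integral {a..b} (\<lambda>t. \<phi> t *\<^sub>R g t)"
  obtains G where "G m = g" "\<And>t. t \<in> {a..b} \<Longrightarrow> G 0 t = h t"
    "\<And>i t. i < m \<Longrightarrow> t \<in> {a..b} \<Longrightarrow> (G i has_vector_derivative G (Suc i) t) (at t within {a..b})"
proof -
  have "\<exists>G. G m = g \<and> (\<forall>t\<in>{a..b}. G 0 t = h t) \<and>
    (\<forall>i<m. \<forall>t\<in>{a..b}. (G i has_vector_derivative G (Suc i) t) (at t within {a..b}))"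
    using g weak
  proof (induction m arbitrary: g)
    case 0
    have c0: "continuous_on {a..b} \<phi>" if "\<phi> \<in> test_functions a b" for \<phi>
      using test_function_continuous[OF that, of _ 0] by simp
    have "g t - h t = 0" if t: "t \<in> {a..b}" for t
    proof (rule du_Bois_Reymond_0[OF ab _ _ t, of "\<lambda>t. g t - h t"])
      show "continuous_on {a..b} (\<lambda>t. g t - h t)" using 0 h by (intro continuous_intros)
      fix \<phi> assume \<phi>: "\<phi> \<in> test_functions a b"
      have "integral {a..b} (\<lambda>t. \<phi> t *\<^sub>R g t - \<phi> t *\<^sub>R h t) = integral {a..b} (\<lambda>t. \<phi> t *\<^sub>R g t) - integral {a..b} (\<lambda>t. \<phi> t *\<^sub>R h t)"
        using 0 h by (intro integral_diff integrable_continuous_interval continuous_intros c0 \<phi>)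
      then show "integral {a..b} (\<lambda>t. \<phi> t *\<^sub>R (g t - h t)) = 0"
        using 0(2)[OF \<phi>] by (simp add: scaleR_diff_right)
    qed
    then show ?case by (intro exI[of _ "\<lambda>_. g"]) simp
  next
    case (Suc m)
    obtain G1 where G1: "\<And>t. t \<in> {a..b} \<Longrightarrow> (G1 has_vector_derivative g t) (at t within {a..b})"
      "\<And>\<phi>. \<phi> \<in> test_functions a b \<Longrightarrow>
        integral {a..b} (\<lambda>t. (deriv ^^ m) \<phi> t *\<^sub>R h t) = (-1) ^ m *\<^sub>R integral {a..b} (\<lambda>t. \<phi> t *\<^sub>R G1 t)"
      using weak_derivative_lower_order[OF ab h Suc.prems] by blast
    have "continuous_on {a..b} G1" using G1(1) by (rule continuous_on_vector_derivative)
    from Suc.IH[OF this G1(2)] obtain G where "G m = G1" "\<forall>t\<in>{a..b}. G 0 t = h t"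
      "\<forall>i<m. \<forall>t\<in>{a..b}. (G i has_vector_derivative G (Suc i) t) (at t within {a..b})" by blast
    then show ?case
      using G1(1) by (intro exI[of _ "G(Suc m := g)"]) (auto simp: less_Suc_eq)
  qed
  then show thesis using that by blast
qed

section \<open>Fractional integrals\<close>

text \<open>Counterpart of \<open>RL_integral\<close> for the Henstock-Kurzweil integral. At order 0
  it is not the identity, so \<alpha> = 1 needs case distinctions wherever the order 1 - \<alpha>
  occurs.\<close>

definition frac_int :: "real \<Rightarrow> real \<Rightarrow> (real \<Rightarrow> 'a::banach) \<Rightarrow> real \<Rightarrow> 'a" where
  "frac_int a \<gamma> u t = (1 / Gamma \<gamma>) *\<^sub>R integral {a..t} (\<lambda>s. (t - s) powr (\<gamma> - 1) *\<^sub>R u s)"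

text \<open>The antiderivative stays continuous at the singular end s = t because \<gamma> > 0, so
  the fundamental theorem with derivatives only in the interior suffices.\<close>

lemma has_integral_kernel:
  fixes a t \<gamma> :: real
  assumes "\<gamma> > 0" "a \<le> t"
  shows "((\<lambda>s. (t - s) powr (\<gamma> - 1)) has_integral (t - a) powr \<gamma> / \<gamma>) {a..t}"
proof -
  have "((\<lambda>s. (t - s) powr (\<gamma> - 1)) has_integral (- ((t - t) powr \<gamma> / \<gamma>) - (- ((t - a) powr \<gamma> / \<gamma>)))) {a..t}"
  proof (rule fundamental_theorem_of_calculus_interior[OF assms(2)])
    show "continuous_on {a..t} (\<lambda>s. - ((t - s) powr \<gamma> / \<gamma>))"
      using assms by (intro continuous_intros continuous_on_powr') auto
    fix s assume "s \<in> {a<..<t}"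
    then have "((\<lambda>s. - ((t - s) powr \<gamma> / \<gamma>)) has_real_derivative (t - s) powr (\<gamma> - 1)) (at s)"
      using assms by (auto intro!: derivative_eq_intros simp: powr_diff)
    then show "((\<lambda>s. - ((t - s) powr \<gamma> / \<gamma>)) has_vector_derivative (t - s) powr (\<gamma> - 1)) (at s)"
      by (simp add: has_real_derivative_iff_has_vector_derivative)
  qed
  then show ?thesis using assms by simp
qed

lemma integrable_kernel_lebesgue:
  fixes a t \<gamma> :: real
  assumes "\<gamma> > 0" "a \<le> t"
  shows "integrable (lebesgue_on {a..t}) (\<lambda>s. (t - s) powr (\<gamma> - 1))"
proof -
  have "(\<lambda>s. (t - s) powr (\<gamma> - 1)) absolutely_integrable_on {a..t}"
    using has_integral_kernel[OF assms] by (intro nonnegative_absolutely_integrable_1) auto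
  then show ?thesis
    by (simp add: set_integrable_def integrable_restrict_space)
qed

lemma has_integral_kernel_bochner:
  fixes u :: "real \<Rightarrow> 'a::banach"
  assumes "\<gamma> > 0" "a < b" "t \<in> {a..b}" "continuous_on {a..b} u"
  shows "((\<lambda>s. (t - s) powr (\<gamma> - 1) *\<^sub>R u s) has_integral
      bochner_integral (lebesgue_on {a..t}) (\<lambda>s. (t - s) powr (\<gamma> - 1) *\<^sub>R u s)) {a..t}"
  using assms by (intro bochner_integral_scaleR_continuous[of _ a b] integrable_kernel_lebesgue) auto

lemma integrable_kernel_continuous:
  fixes u :: "real \<Rightarrow> 'a::banach"
  assumes "\<gamma> > 0" "a < b" "t \<in> {a..b}" "continuous_on {a..b} u"
  shows "(\<lambda>s. (t - s) powr (\<gamma> - 1) *\<^sub>R u s) integrable_on {a..t}"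
  using has_integral_kernel_bochner[OF assms] by blast

lemma RL_integral_eq_frac_int:
  fixes u :: "real \<Rightarrow> 'a::banach"
  assumes "\<gamma> > 0" "a < b" "t \<in> {a..b}" "continuous_on {a..b} u"
  shows "RL_integral a \<gamma> u t = frac_int a \<gamma> u t"
  using integral_unique[OF has_integral_kernel_bochner[OF assms]] assms(1)
  by (simp add: RL_integral_def frac_int_def)

lemma frac_int_1: "a \<le> t \<Longrightarrow> frac_int a 1 u t = integral {a..t} u"
  unfolding frac_int_def
  \<comment> \<open>The point t is exceptional since \<open>0 powr 0\<close> is 0, so there the
    kernel is 0 and not 1.\<close>
  by (simp, intro integral_spike[of "{t}"]) auto

lemma frac_int_at_start [simp]: "frac_int a \<gamma> u a = 0"
  by (simp add: frac_int_def)

text \<open>The kernel has integral (t - a)^\<gamma> / \<gamma>, and \<gamma> * Gamma \<gamma> =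
  Gamma (\<gamma> + 1). The bound on u is asked only in the open interval, since step approximations
  are not controlled at a.\<close>

lemma norm_frac_int_le:
  fixes u :: "real \<Rightarrow> 'a::banach"
  assumes \<gamma>: "\<gamma> > 0" and at: "a \<le> t"
    and int: "(\<lambda>s. (t - s) powr (\<gamma> - 1) *\<^sub>R u s) integrable_on {a..t}"
    and bound: "\<And>s. a < s \<Longrightarrow> s < t \<Longrightarrow> norm (u s) \<le> B"
  shows "norm (frac_int a \<gamma> u t) \<le> B * (t - a) powr \<gamma> / Gamma (\<gamma> + 1)"
proof -
  let ?k = "\<lambda>s. (t - s) powr (\<gamma> - 1)"
  have k: "((\<lambda>s. ?k s * B) has_integral (t - a) powr \<gamma> / \<gamma> * B) {a..t}"
    by (rule has_integral_mult_left[OF has_integral_kernel[OF \<gamma> at]])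
  have "norm (integral {a<..<t} (\<lambda>s. ?k s *\<^sub>R u s)) \<le> integral {a<..<t} (\<lambda>s. ?k s * B)"
  proof (rule integral_norm_bound_integral)
    show "(\<lambda>s. ?k s *\<^sub>R u s) integrable_on {a<..<t}" using int by (simp add: integrable_on_Icc_iff_Ioo)
    show "(\<lambda>s. ?k s * B) integrable_on {a<..<t}"
      using has_integral_integrable[OF k] by (simp only: integrable_on_Icc_iff_Ioo)
  qed (use bound in \<open>auto intro!: mult_left_mono\<close>)
  then have "norm (integral {a..t} (\<lambda>s. ?k s *\<^sub>R u s)) \<le> (t - a) powr \<gamma> / \<gamma> * B"
    using integral_unique[OF k] by (simp add: integral_open_interval_real)
  moreover have "Gamma (\<gamma> + 1) = \<gamma> * Gamma \<gamma>"
    using \<gamma> by (subst Gamma_plus1) (auto elim!: nonpos_Ints_cases)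
  moreover have "Gamma \<gamma> > 0" using \<gamma> by simp
  moreover from this have "Gamma \<gamma> \<noteq> 0" by linarith
  ultimately show ?thesis
    using \<gamma> by (simp add: frac_int_def field_simps)
qed

text \<open>Euler's Beta integral under the substitution s = c + (t - c) x. Truncation at c lets one
  formula cover t \<le> c as well, where both sides are 0.\<close>

lemma has_integral_kernel_powr:
  fixes a c t \<beta> p :: real
  assumes ac: "a \<le> c" and \<beta>: "\<beta> > 0" and p: "p > -1"
  shows "((\<lambda>s. (t - s) powr (\<beta> - 1) * max 0 (s - c) powr p) has_integral
    Gamma \<beta> * (Gamma (p + 1) / Gamma (p + 1 + \<beta>) * max 0 (t - c) powr (p + \<beta>))) {a..t}"
proof (cases "t \<le> c")
  case True
  have "((\<lambda>s. (t - s) powr (\<beta> - 1) * max 0 (s - c) powr p) has_integral 0) {a..t}"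
    by (rule has_integral_is_0) (use True in auto)
  then show ?thesis using True by simp
next
  case False
  define m where "m = t - c"
  have m: "m > 0" using False by (simp add: m_def)
  let ?f = "\<lambda>s. (t - s) powr (\<beta> - 1) * (s - c) powr p"
  let ?C = "Gamma (p + 1) * Gamma \<beta> / Gamma (p + 1 + \<beta>)"
  have Beta: "Beta (p + 1) \<beta> = ?C" by (simp add: Beta_def)
  have "((\<lambda>x. x powr (p + 1 - 1) * (1 - x) powr (\<beta> - 1)) has_integral ?C) {0..1}"
    using has_integral_Beta_real[of "p + 1" \<beta>] p \<beta> unfolding Beta by simp
  from has_integral_mult_right[OF this, of "m powr (p + \<beta> - 1)"]
  have "((\<lambda>x. ?f (m * x + c)) has_integral m powr (p + \<beta> - 1) * ?C) {0..1}"
  proof (rule has_integral_eq[rotated])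
    fix x :: real
    have "t - (m * x + c) = m * (1 - x)" "m * x + c - c = m * x" by (simp_all add: m_def algebra_simps)
    moreover have "m powr (p + \<beta> - 1) = m powr p * m powr (\<beta> - 1)"
      by (simp add: add_diff_eq flip: powr_add)
    ultimately show "m powr (p + \<beta> - 1) * (x powr (p + 1 - 1) * (1 - x) powr (\<beta> - 1)) = ?f (m * x + c)"
      by (simp add: powr_mult mult_ac)
  qed
  \<comment> \<open>The quotient by m is the Jacobian expected by
    \<open>has_integral_affinity_iff\<close>.\<close>
  also have "m powr (p + \<beta> - 1) * ?C = (m powr (p + \<beta>) * ?C) / m"
    using m by (simp add: powr_diff)
  finally have "(?f has_integral m powr (p + \<beta>) * ?C) {c..t}"
    using has_integral_affinity_iff[OF m, of ?f c "m powr (p + \<beta>) * ?C" c t] m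
    by (simp add: m_def divide_inverse mult.commute)
  then have "((\<lambda>s. (t - s) powr (\<beta> - 1) * max 0 (s - c) powr p) has_integral m powr (p + \<beta>) * ?C) {c..t}"
    by (rule has_integral_eq[rotated]) auto
  moreover have "((\<lambda>s. (t - s) powr (\<beta> - 1) * max 0 (s - c) powr p) has_integral 0) {a..c}"
    by (rule has_integral_is_0) auto
  ultimately have "((\<lambda>s. (t - s) powr (\<beta> - 1) * max 0 (s - c) powr p) has_integral 0 + m powr (p + \<beta>) * ?C) {a..t}"
    using ac False by (intro has_integral_combine[of a c t]) auto
  then show ?thesis using m by (simp add: m_def mult_ac)
qed

lemma has_integral_kernel_powr_scaleR:
  fixes a c t \<beta> p :: real and x :: "'a::banach"
  assumes "a \<le> c" "\<beta> > 0" "p > -1"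
  shows "((\<lambda>s. (t - s) powr (\<beta> - 1) *\<^sub>R (r * max 0 (s - c) powr p) *\<^sub>R x) has_integral
    Gamma \<beta> *\<^sub>R (r * (Gamma (p + 1) / Gamma (p + 1 + \<beta>)) * max 0 (t - c) powr (p + \<beta>)) *\<^sub>R x) {a..t}"
  using has_integral_scaleR_left[OF has_integral_mult_right[OF has_integral_kernel_powr[OF assms, of t], of r], of x]
  by (simp add: mult_ac)

lemma frac_int_powr:
  fixes a c t \<beta> p :: real and x :: "'a::banach"
  assumes "a \<le> c" "\<beta> > 0" "p > -1"
  shows "frac_int a \<beta> (\<lambda>s. (r * max 0 (s - c) powr p) *\<^sub>R x) t
    = (r * (Gamma (p + 1) / Gamma (p + 1 + \<beta>)) * max 0 (t - c) powr (p + \<beta>)) *\<^sub>R x"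
proof -
  have "Gamma \<beta> \<noteq> 0" using assms(2) by (simp add: less_imp_neq[THEN not_sym])
  then show ?thesis
    unfolding frac_int_def integral_unique[OF has_integral_kernel_powr_scaleR[OF assms]] by simp
qed

text \<open>For p = 0 the argument is a step function, for p = \<beta> the fractional integral of
  one; the factor r carries the Gamma quotient from one integration to the next.\<close>

lemma frac_int_sum_powr:
  fixes c :: "nat \<Rightarrow> real" and x :: "nat \<Rightarrow> 'a::banach"
  assumes c: "\<And>i. i < N \<Longrightarrow> a \<le> c i" and \<beta>: "\<beta> > 0" and p: "p > -1"
  shows "(\<lambda>s. (t - s) powr (\<beta> - 1) *\<^sub>R (\<Sum>i<N. (r * max 0 (s - c i) powr p) *\<^sub>R x i)) integrable_on {a..t}"
    and "frac_int a \<beta> (\<lambda>s. \<Sum>i<N. (r * max 0 (s - c i) powr p) *\<^sub>R x i) t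
      = (\<Sum>i<N. (r * (Gamma (p + 1) / Gamma (p + 1 + \<beta>)) * max 0 (t - c i) powr (p + \<beta>)) *\<^sub>R x i)"
proof -
  have int: "((\<lambda>s. (t - s) powr (\<beta> - 1) *\<^sub>R (\<Sum>i<N. (r * max 0 (s - c i) powr p) *\<^sub>R x i)) has_integral
    (\<Sum>i<N. Gamma \<beta> *\<^sub>R (r * (Gamma (p + 1) / Gamma (p + 1 + \<beta>)) * max 0 (t - c i) powr (p + \<beta>)) *\<^sub>R x i)) {a..t}"
    unfolding scaleR_sum_right
    using c \<beta> p by (intro has_integral_sum has_integral_kernel_powr_scaleR) auto
  then show "(\<lambda>s. (t - s) powr (\<beta> - 1) *\<^sub>R (\<Sum>i<N. (r * max 0 (s - c i) powr p) *\<^sub>R x i)) integrable_on {a..t}"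
    by blast
  have "Gamma \<beta> \<noteq> 0" using \<beta> by (simp add: less_imp_neq[THEN not_sym])
  then show "frac_int a \<beta> (\<lambda>s. \<Sum>i<N. (r * max 0 (s - c i) powr p) *\<^sub>R x i) t
      = (\<Sum>i<N. (r * (Gamma (p + 1) / Gamma (p + 1 + \<beta>)) * max 0 (t - c i) powr (p + \<beta>)) *\<^sub>R x i)"
    unfolding frac_int_def integral_unique[OF int] by (simp add: scaleR_sum_right)
qed

section \<open>Norm bounds and Hoelder regularity of fractional integrals, and the semigroup
  law\<close>

lemma frac_int_diff:
  assumes "(\<lambda>s. (t - s) powr (\<gamma> - 1) *\<^sub>R u s) integrable_on {a..t}"
    and "(\<lambda>s. (t - s) powr (\<gamma> - 1) *\<^sub>R v s) integrable_on {a..t}"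
  shows "frac_int a \<gamma> (\<lambda>s. u s - v s) t = frac_int a \<gamma> u t - frac_int a \<gamma> v t"
  using integral_diff[OF assms] by (simp add: frac_int_def scaleR_diff_right)

lemma norm_frac_int_diff_le:
  fixes u :: "real \<Rightarrow> 'a::banach"
  assumes \<gamma>: "\<gamma> > 0" and at: "a \<le> t"
    and u: "(\<lambda>s. (t - s) powr (\<gamma> - 1) *\<^sub>R u s) integrable_on {a..t}"
    and v: "(\<lambda>s. (t - s) powr (\<gamma> - 1) *\<^sub>R v s) integrable_on {a..t}"
    and bound: "\<And>s. a < s \<Longrightarrow> s < t \<Longrightarrow> norm (u s - v s) \<le> B"
  shows "norm (frac_int a \<gamma> u t - frac_int a \<gamma> v t) \<le> B * (t - a) powr \<gamma> / Gamma (\<gamma> + 1)"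
  unfolding frac_int_diff[OF u v, symmetric]
  using integrable_diff[OF u v]
  by (intro norm_frac_int_le[OF \<gamma> at _ bound]) (auto simp: scaleR_diff_right)

text \<open>For s \<le> t the integral is cut at s. On [a, s] the kernel decreases as s moves to t,
  because \<gamma> \<le> 1, so the absolute difference of the kernels can be integrated exactly and
  gives at most (t - s)^\<gamma> / \<gamma>. The piece over [s, t] gives the same amount; hence the
  factor 2.\<close>

lemma frac_int_Hoelder:
  fixes u :: "real \<Rightarrow> 'a::banach"
  assumes \<gamma>: "0 < \<gamma>" "\<gamma> \<le> 1" and ab: "a < b" and u: "continuous_on {a..b} u"
    and B: "\<And>r. r \<in> {a..b} \<Longrightarrow> norm (u r) \<le> B" and st: "s \<in> {a..b}" "t \<in> {a..b}"
  shows "norm (frac_int a \<gamma> u t - frac_int a \<gamma> u s) \<le> 2 * B / Gamma (\<gamma> + 1) * \<bar>t - s\<bar> powr \<gamma>"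
proof -
  have "B \<ge> 0" using order_trans[OF norm_ge_zero B[of a]] ab by simp
  have G: "Gamma (\<gamma> + 1) = \<gamma> * Gamma \<gamma>" "Gamma \<gamma> > 0"
    by (subst Gamma_plus1, use \<gamma> in \<open>auto elim!: nonpos_Ints_cases\<close>)
  have *: "norm (frac_int a \<gamma> u t - frac_int a \<gamma> u s) \<le> 2 * B / Gamma (\<gamma> + 1) * (t - s) powr \<gamma>"
    if st: "s \<in> {a..b}" "t \<in> {a..b}" and less: "s \<le> t" for s t
  proof -
    let ?k = "\<lambda>t r. (t - r) powr (\<gamma> - 1)"
    have as: "a \<le> s" "a \<le> t" using st by auto
    have kt: "(\<lambda>r. ?k t r *\<^sub>R u r) integrable_on {a..t}" and ks: "(\<lambda>r. ?k s r *\<^sub>R u r) integrable_on {a..s}"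
      using integrable_kernel_continuous[OF \<gamma>(1) ab _ u] st by auto
    have kt1: "(\<lambda>r. ?k t r *\<^sub>R u r) integrable_on {a..s}" and kt2: "(\<lambda>r. ?k t r *\<^sub>R u r) integrable_on {s..t}"
      using kt less st by (auto intro: integrable_subinterval_real)
    have split: "integral {a..s} (\<lambda>r. ?k t r *\<^sub>R u r) + integral {s..t} (\<lambda>r. ?k t r *\<^sub>R u r) = integral {a..t} (\<lambda>r. ?k t r *\<^sub>R u r)"
      using as less kt by (intro Henstock_Kurzweil_Integration.integral_combine) auto
    have rk: "?k t integrable_on {a..t}" using has_integral_kernel[OF \<gamma>(1) as(2)] by blast
    then have rk1: "?k t integrable_on {a..s}" using less as by (auto intro: integrable_subinterval_real)
    have rsplit: "integral {a..s} (?k t) + integral {s..t} (?k t) = integral {a..t} (?k t)"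
      using as less rk by (intro Henstock_Kurzweil_Integration.integral_combine) auto
    have rs: "?k s integrable_on {a..s}" using has_integral_kernel[OF \<gamma>(1) as(1)] by blast
    have vals: "integral {a..t} (?k t) = (t - a) powr \<gamma> / \<gamma>" "integral {s..t} (?k t) = (t - s) powr \<gamma> / \<gamma>"
      "integral {a..s} (?k s) = (s - a) powr \<gamma> / \<gamma>"
      using has_integral_kernel[OF \<gamma>(1)] as less by (auto intro!: integral_unique)
    \<comment> \<open>The end point s is left out: there the kernel of s is
      \<open>0 powr (\<gamma> - 1)\<close>, which is 0, so it does not dominate the kernel of t if s
      < t.\<close>
    have 1: "norm (integral {a<..<s} (\<lambda>r. ?k t r *\<^sub>R u r - ?k s r *\<^sub>R u r)) \<le> integral {a<..<s} (\<lambda>r. (?k s r - ?k t r) * B)"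
    proof (rule integral_norm_bound_integral)
      show "(\<lambda>r. ?k t r *\<^sub>R u r - ?k s r *\<^sub>R u r) integrable_on {a<..<s}"
        using integrable_diff[OF kt1 ks] by (simp add: integrable_on_Icc_iff_Ioo)
      show "(\<lambda>r. (?k s r - ?k t r) * B) integrable_on {a<..<s}"
        using integrable_on_mult_left[OF integrable_diff[OF rs rk1], of B] by (simp only: integrable_on_Icc_iff_Ioo)
      fix r assume r: "r \<in> {a<..<s}"
      have le: "?k t r \<le> ?k s r" using r less \<gamma> by (intro powr_mono2') auto
      have "norm (?k t r *\<^sub>R u r - ?k s r *\<^sub>R u r) = (?k s r - ?k t r) * norm (u r)"
        using le by (simp flip: scaleR_diff_left)
      also have "\<dots> \<le> (?k s r - ?k t r) * B"
        using le r st by (intro mult_left_mono B) auto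
      finally show "norm (?k t r *\<^sub>R u r - ?k s r *\<^sub>R u r) \<le> (?k s r - ?k t r) * B" .
    qed
    have i1: "integral {a<..<s} (\<lambda>r. ?k t r *\<^sub>R u r - ?k s r *\<^sub>R u r) = integral {a..s} (\<lambda>r. ?k t r *\<^sub>R u r) - integral {a..s} (\<lambda>r. ?k s r *\<^sub>R u r)"
      unfolding integral_open_interval_real[symmetric] by (rule integral_diff[OF kt1 ks])
    have i2: "integral {a<..<s} (\<lambda>r. (?k s r - ?k t r) * B) = ((s - a) powr \<gamma> / \<gamma> - (t - a) powr \<gamma> / \<gamma> + (t - s) powr \<gamma> / \<gamma>) * B"
      unfolding integral_open_interval_real[symmetric] integral_mult_left
      using integral_diff[OF rs rk1] rsplit vals by simp
    have 2: "norm (integral {s..t} (\<lambda>r. ?k t r *\<^sub>R u r)) \<le> integral {s..t} (\<lambda>r. ?k t r * B)"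
    proof (rule integral_norm_bound_integral[OF kt2])
      show "(\<lambda>r. ?k t r * B) integrable_on {s..t}"
        using has_integral_kernel[OF \<gamma>(1) less] by (intro integrable_on_mult_left) blast
    qed (use st in \<open>auto intro!: mult_left_mono B\<close>)
    have i3: "integral {s..t} (\<lambda>r. ?k t r * B) = (t - s) powr \<gamma> / \<gamma> * B"
      unfolding integral_mult_left using vals by simp
    have "(s - a) powr \<gamma> \<le> (t - a) powr \<gamma>" using as less \<gamma> by (intro powr_mono2) auto
    \<comment> \<open>The part of the first estimate that is discarded.\<close>
    then have mono: "((s - a) powr \<gamma> / \<gamma> - (t - a) powr \<gamma> / \<gamma>) * B \<le> 0"
      using \<gamma> \<open>B \<ge> 0\<close> by (intro mult_nonpos_nonneg) (auto simp: divide_right_mono)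
    have "norm (integral {a..t} (\<lambda>r. ?k t r *\<^sub>R u r) - integral {a..s} (\<lambda>r. ?k s r *\<^sub>R u r))
        = norm ((integral {a..s} (\<lambda>r. ?k t r *\<^sub>R u r) - integral {a..s} (\<lambda>r. ?k s r *\<^sub>R u r)) + integral {s..t} (\<lambda>r. ?k t r *\<^sub>R u r))"
      unfolding split[symmetric] by (simp add: algebra_simps)
    also have "\<dots> \<le> ((s - a) powr \<gamma> / \<gamma> - (t - a) powr \<gamma> / \<gamma> + (t - s) powr \<gamma> / \<gamma>) * B + (t - s) powr \<gamma> / \<gamma> * B"
      using 1 2 unfolding i1 i2 i3 by (intro norm_triangle_le add_mono)
    also have "\<dots> \<le> 2 * B / \<gamma> * (t - s) powr \<gamma>"
      using mono by (simp add: algebra_simps)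
    finally have main: "norm (integral {a..t} (\<lambda>r. ?k t r *\<^sub>R u r) - integral {a..s} (\<lambda>r. ?k s r *\<^sub>R u r)) \<le> 2 * B / \<gamma> * (t - s) powr \<gamma>" .
    have "norm (frac_int a \<gamma> u t - frac_int a \<gamma> u s)
      = (1 / Gamma \<gamma>) * norm (integral {a..t} (\<lambda>r. ?k t r *\<^sub>R u r) - integral {a..s} (\<lambda>r. ?k s r *\<^sub>R u r))"
      using G by (simp add: frac_int_def flip: scaleR_diff_right)
    also have "\<dots> \<le> (1 / Gamma \<gamma>) * (2 * B / \<gamma> * (t - s) powr \<gamma>)"
      using G main by (intro mult_left_mono) auto
    also have "\<dots> = 2 * B / Gamma (\<gamma> + 1) * (t - s) powr \<gamma>"
      using G by simp
    finally show ?thesis .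
  qed
  show ?thesis
  proof (cases "s \<le> t")
    case True
    then show ?thesis using *[OF st] by simp
  next
    case False
    then show ?thesis using *[OF st(2,1)] by (simp add: norm_minus_commute)
  qed
qed

lemma continuous_on_Hoelder:
  fixes f :: "real \<Rightarrow> 'a::real_normed_vector"
  assumes \<gamma>: "\<gamma> > 0" and f: "\<And>s t. s \<in> S \<Longrightarrow> t \<in> S \<Longrightarrow> norm (f t - f s) \<le> C * \<bar>t - s\<bar> powr \<gamma>"
  shows "continuous_on S f"
  unfolding continuous_on_def
proof
  fix s assume s: "s \<in> S"
  have "((\<lambda>t. C * \<bar>t - s\<bar> powr \<gamma>) \<longlongrightarrow> C * \<bar>s - s\<bar> powr \<gamma>) (at s within S)"
    using \<gamma> by (intro tendsto_intros tendsto_powr') auto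
  then have "((\<lambda>t. C * \<bar>t - s\<bar> powr \<gamma>) \<longlongrightarrow> 0) (at s within S)" by simp
  then have "((\<lambda>t. f t - f s) \<longlongrightarrow> 0) (at s within S)"
    by (rule Lim_null_comparison[rotated]) (use f s in \<open>auto simp: eventually_at_filter\<close>)
  then show "(f \<longlongrightarrow> f s) (at s within S)" by (simp add: Lim_null[symmetric])
qed

lemma continuous_on_frac_int:
  fixes u :: "real \<Rightarrow> 'a::banach"
  assumes \<gamma>: "0 < \<gamma>" "\<gamma> \<le> 1" and ab: "a < b" and u: "continuous_on {a..b} u"
  shows "continuous_on {a..b} (frac_int a \<gamma> u)"
proof -
  obtain B where "\<And>s. s \<in> {a..b} \<Longrightarrow> norm (u s) \<le> B"
    using continuous_on_Icc_norm_bound[OF u] by blast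
  from continuous_on_Hoelder[OF \<gamma>(1) frac_int_Hoelder[OF \<gamma> ab u this]] show ?thesis .
qed

text \<open>On step functions both sides are explicit and the Gamma factors cancel. Both sides are
  bounded operators for the sup norm on the half-open interval from a, so the law passes to the
  limit. The condition \<beta> \<le> 1 supplies continuity of the inner integral.\<close>

lemma frac_int_semigroup:
  fixes u :: "real \<Rightarrow> 'a::banach"
  assumes \<alpha>: "\<alpha> > 0" and \<beta>: "0 < \<beta>" "\<beta> \<le> 1" and ab: "a < b" and u: "continuous_on {a..b} u"
    and t: "t \<in> {a..b}"
  shows "frac_int a \<alpha> (frac_int a \<beta> u) t = frac_int a (\<alpha> + \<beta>) u t"
proof -
  have \<alpha>\<beta>: "\<alpha> + \<beta> > 0" using \<alpha> \<beta> by simp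
  \<comment> \<open>Sum of the bounds of the iterated and of the single integral for an
    approximation error of size 1.\<close>
  define K where "K = (b - a) powr \<beta> / Gamma (\<beta> + 1) * (t - a) powr \<alpha> / Gamma (\<alpha> + 1) + (t - a) powr (\<alpha> + \<beta>) / Gamma (\<alpha> + \<beta> + 1)"
  have K: "K \<ge> 0" unfolding K_def using \<alpha> \<beta>
    by (intro add_nonneg_nonneg mult_nonneg_nonneg divide_nonneg_nonneg powr_ge_zero) (auto intro!: less_imp_le)
  have approx: "norm (frac_int a \<alpha> (frac_int a \<beta> u) t - frac_int a (\<alpha> + \<beta>) u t) \<le> e * K" if e: "e > 0" for e
  proof -
    obtain N :: nat and c x where c: "\<And>i. i < N \<Longrightarrow> a \<le> c i \<and> c i < b"
      and cx: "\<And>s. a < s \<Longrightarrow> s \<le> b \<Longrightarrow> norm (u s - (\<Sum>i<N. indicat_real {c i<..} s *\<^sub>R x i)) \<le> e"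
      using step_approx[OF u ab e] by blast
    have ca: "a \<le> c i" if "i < N" for i using c that by simp
    define v where "v = (\<lambda>s. \<Sum>i<N. (1 * max 0 (s - c i) powr 0) *\<^sub>R x i)"
    \<comment> \<open>The convention \<open>0 powr 0 = 0\<close> makes the truncated power of
      exponent 0 the indicator of the open half-line.\<close>
    have ind: "indicat_real {c i<..} s = 1 * max 0 (s - c i) powr 0" for i s
      by (auto simp: indicator_def)
    have uv: "norm (u s - v s) \<le> e" if "a < s" "s \<le> b" for s
      using cx[OF that] unfolding v_def ind .
    have v_int: "(\<lambda>s. (r - s) powr (\<gamma> - 1) *\<^sub>R v s) integrable_on {a..r}" if "\<gamma> > 0" for r \<gamma>
      unfolding v_def by (rule frac_int_sum_powr(1)[OF ca that]) auto
    have v_frac: "frac_int a \<gamma> v r = (\<Sum>i<N. (1 / Gamma (1 + \<gamma>) * max 0 (r - c i) powr \<gamma>) *\<^sub>R x i)" if "\<gamma> > 0" for r \<gamma>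
      unfolding v_def using frac_int_sum_powr(2)[OF ca that, where r=1 and p=0] by simp
    have bv: "norm (frac_int a \<beta> u s - frac_int a \<beta> v s) \<le> e * (b - a) powr \<beta> / Gamma (\<beta> + 1)" if s: "a < s" "s < t" for s
    proof -
      have "norm (frac_int a \<beta> u s - frac_int a \<beta> v s) \<le> e * (s - a) powr \<beta> / Gamma (\<beta> + 1)"
        using s t \<beta> by (intro norm_frac_int_diff_le integrable_kernel_continuous[OF _ ab _ u] v_int uv) auto
      also have "\<dots> \<le> e * (b - a) powr \<beta> / Gamma (\<beta> + 1)"
        using s t e \<beta> by (intro divide_right_mono mult_left_mono powr_mono2) (auto intro!: less_imp_le)
      finally show ?thesis .
    qed
    have v_comp: "frac_int a \<beta> v = (\<lambda>r. \<Sum>i<N. (1 / Gamma (1 + \<beta>) * max 0 (r - c i) powr \<beta>) *\<^sub>R x i)"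
      using v_frac[OF \<beta>(1)] by blast
    have "norm (frac_int a \<alpha> (frac_int a \<beta> u) t - frac_int a \<alpha> (frac_int a \<beta> v) t)
        \<le> (e * (b - a) powr \<beta> / Gamma (\<beta> + 1)) * (t - a) powr \<alpha> / Gamma (\<alpha> + 1)"
    proof (rule norm_frac_int_diff_le[OF \<alpha> _ _ _ bv])
      show "(\<lambda>s. (t - s) powr (\<alpha> - 1) *\<^sub>R frac_int a \<beta> u s) integrable_on {a..t}"
        by (intro integrable_kernel_continuous[OF \<alpha> ab t] continuous_on_frac_int \<beta> ab u)
      show "(\<lambda>s. (t - s) powr (\<alpha> - 1) *\<^sub>R frac_int a \<beta> v s) integrable_on {a..t}"
        unfolding v_comp using \<beta> by (intro frac_int_sum_powr(1) ca \<alpha>) auto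
    qed (use t in auto)
    moreover have "norm (frac_int a (\<alpha> + \<beta>) u t - frac_int a (\<alpha> + \<beta>) v t) \<le> e * (t - a) powr (\<alpha> + \<beta>) / Gamma (\<alpha> + \<beta> + 1)"
      using t by (intro norm_frac_int_diff_le[OF \<alpha>\<beta>] integrable_kernel_continuous[OF \<alpha>\<beta> ab t u] v_int[OF \<alpha>\<beta>] uv) auto
    moreover have "frac_int a \<alpha> (frac_int a \<beta> v) t = frac_int a (\<alpha> + \<beta>) v t"
    proof -
      have G: "Gamma (1 + \<beta>) > 0" using \<beta> by simp
      show ?thesis
        unfolding v_frac[OF \<alpha>\<beta>] v_comp
        using frac_int_sum_powr(2)[OF ca \<alpha>, where r="1 / Gamma (1 + \<beta>)" and p=\<beta>] \<beta> G
        by (simp add: add_ac)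
    qed
    ultimately have "norm (frac_int a \<alpha> (frac_int a \<beta> u) t - frac_int a (\<alpha> + \<beta>) u t)
      \<le> (e * (b - a) powr \<beta> / Gamma (\<beta> + 1)) * (t - a) powr \<alpha> / Gamma (\<alpha> + 1) + e * (t - a) powr (\<alpha> + \<beta>) / Gamma (\<alpha> + \<beta> + 1)"
      by (smt (verit) norm_diff_triangle_le norm_minus_commute)
    then show ?thesis by (simp add: K_def algebra_simps)
  qed
  have "norm (frac_int a \<alpha> (frac_int a \<beta> u) t - frac_int a (\<alpha> + \<beta>) u t) \<le> 0"
  proof (rule field_le_epsilon)
    fix e :: real assume e: "e > 0"
    \<comment> \<open>K + 1 and not K, since K is 0 at t = a.\<close>
    have "e / (K + 1) * K \<le> e" using K e by (simp add: field_simps)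
    then show "norm (frac_int a \<alpha> (frac_int a \<beta> u) t - frac_int a (\<alpha> + \<beta>) u t) \<le> 0 + e"
      using approx[of "e / (K + 1)"] K e by simp
  qed
  then show ?thesis by simp
qed

section \<open>Riemann--Liouville and Hoelder spaces\<close>

lemma nderiv_0 [simp]: "nderiv a b 0 f = f"
  by (simp add: nderiv_def)

lemma nderiv_Suc: "nderiv a b (Suc k) f = (\<lambda>t. vector_derivative (nderiv a b k f) (at t within {a..b}))"
  by (simp add: nderiv_def)

text \<open>One-sided derivatives on a nondegenerate interval are unique, so any explicit chain of
  derivatives computes \<open>nderiv\<close>.\<close>

lemma nderiv_eq_chain:
  assumes ab: "a < b" and F0: "\<And>t. t \<in> {a..b} \<Longrightarrow> f t = F 0 t"
    and F: "\<And>i t. i < k \<Longrightarrow> t \<in> {a..b} \<Longrightarrow> (F i has_vector_derivative F (Suc i) t) (at t within {a..b})"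
  shows "i \<le> k \<Longrightarrow> t \<in> {a..b} \<Longrightarrow> nderiv a b i f t = F i t"
proof (induction i arbitrary: t)
  case (Suc i)
  have "(nderiv a b i f has_vector_derivative F (Suc i) t) (at t within {a..b})"
    using Suc by (intro has_vector_derivative_transform[OF _ _ F]) auto
  then show ?case
    using vector_derivative_within_cbox[OF ab] Suc.prems by (auto simp: nderiv_Suc)
qed (use F0 in simp)

lemma nderiv_has_vector_derivative:
  assumes "f \<in> Ck_space k a b" "j < k" "t \<in> {a..b}"
  shows "(nderiv a b j f has_vector_derivative nderiv a b (Suc j) f t) (at t within {a..b})"
  using assms unfolding Ck_space_def nderiv_Suc
  by (auto simp: differentiable_on_def vector_derivative_works)

lemma nderiv_continuous_on:
  assumes "f \<in> Ck_space k a b" "j \<le> k"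
  shows "continuous_on {a..b} (nderiv a b j f)"
proof (cases "j = k")
  case False
  then show ?thesis
    using assms by (intro continuous_on_vector_derivative[OF nderiv_has_vector_derivative]) auto
qed (use assms in \<open>simp add: Ck_space_def\<close>)

lemma Ck_spaceI_chain:
  assumes ab: "a < b" and F0: "\<And>t. t \<in> {a..b} \<Longrightarrow> f t = F 0 t"
    and F: "\<And>i t. i < k \<Longrightarrow> t \<in> {a..b} \<Longrightarrow> (F i has_vector_derivative F (Suc i) t) (at t within {a..b})"
    and Fk: "continuous_on {a..b} (F k)"
  shows "f \<in> Ck_space k a b"
proof -
  have eq: "nderiv a b i f t = F i t" if "i \<le> k" "t \<in> {a..b}" for i t
    by (rule nderiv_eq_chain[where F=F, OF ab F0 F that])
  have "continuous_on {a..b} (nderiv a b k f)"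
    using Fk by (rule continuous_on_eq) (simp add: eq)
  moreover have "nderiv a b j f differentiable_on {a..b}" if "j < k" for j
    unfolding differentiable_on_def
  proof
    fix t assume t: "t \<in> {a..b}"
    have "(nderiv a b j f has_vector_derivative F (Suc j) t) (at t within {a..b})"
      using that t by (intro has_vector_derivative_transform[OF _ _ F]) (auto simp: eq)
    then show "nderiv a b j f differentiable (at t within {a..b})"
      by (auto simp: has_vector_derivative_def differentiable_def)
  qed
  ultimately show ?thesis by (simp add: Ck_space_def)
qed

lemma Ck_norm_nonneg:
  fixes f :: "real \<Rightarrow> 'a::banach"
  assumes f: "f \<in> Ck_space k a b" and ab: "a < b"
  shows "Ck_norm k a b f \<ge> 0"
  unfolding Ck_norm_def
proof (rule sum_nonneg)
  fix j assume "j \<in> {..k}"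
  then obtain B where "\<And>s. s \<in> {a..b} \<Longrightarrow> norm (nderiv a b j f s) \<le> B"
    using continuous_on_Icc_norm_bound[OF nderiv_continuous_on[OF f]] by auto
  then have "bdd_above ((\<lambda>t. norm (nderiv a b j f t)) ` {a..b})" by (intro bdd_aboveI2[of _ _ B]) auto
  then show "0 \<le> (SUP t\<in>{a..b}. norm (nderiv a b j f t))"
    using ab by (intro cSUP_upper2[of _ _ a]) auto
qed

section \<open>From a continuous fractional derivative to Hoelder regularity\<close>

lemma ceiling_add_unit_interval:
  assumes "0 < \<alpha>" "\<alpha> \<le> 1"
  shows "\<lceil>real n + \<alpha>\<rceil> = int (Suc n)"
  using assms by (intro ceiling_unique) auto

lemma nat_ceiling_minus_1:
  assumes "0 < \<alpha>" "\<alpha> \<le> 1"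
  shows "nat \<lceil>real n + \<alpha>\<rceil> - 1 = n"
  by (simp add: ceiling_add_unit_interval[OF assms])

lemma frac_int_cong:
  assumes "\<And>s. s \<in> {a..t} \<Longrightarrow> u s = v s"
  shows "frac_int a \<gamma> u t = frac_int a \<gamma> v t"
proof -
  have "integral {a..t} (\<lambda>s. (t - s) powr (\<gamma> - 1) *\<^sub>R u s) = integral {a..t} (\<lambda>s. (t - s) powr (\<gamma> - 1) *\<^sub>R v s)"
    using assms by (intro integral_cong) simp
  then show ?thesis by (simp add: frac_int_def)
qed

text \<open>Moves from the Bochner and weak formulation to classical derivatives: G runs from
  J^(1-\<alpha>) f, or f itself if \<alpha> = 1, up to g.\<close>

lemma RL_deriv_chain:
  fixes f g :: "real \<Rightarrow> 'a::banach"
  assumes ab: "a < b" and \<alpha>: "0 < \<alpha>" "\<alpha> \<le> 1"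
    and f: "continuous_on {a..b} f" and g: "continuous_on {a..b} g"
    and RL: "is_RL_deriv a b (real n + \<alpha>) f g"
  obtains G where "G (Suc n) = g"
    "\<And>t. t \<in> {a..b} \<Longrightarrow> G 0 t = (if \<alpha> = 1 then f t else frac_int a (1 - \<alpha>) f t)"
    "\<And>i t. i < Suc n \<Longrightarrow> t \<in> {a..b} \<Longrightarrow> (G i has_vector_derivative G (Suc i) t) (at t within {a..b})"
proof -
  define h where "h t = (if \<alpha> = 1 then f t else frac_int a (1 - \<alpha>) f t)" for t
  define h0 where "h0 = RL_integral a (1 - \<alpha>) f"
  \<comment> \<open>Equality is available only on [a, b], where f is continuous and its kernel
    integrals exist; hence two names.\<close>
  have h0: "h0 t = h t" if "t \<in> {a..b}" for t
    using RL_integral_eq_frac_int[OF _ ab that f, of "1 - \<alpha>"] \<alpha>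
    by (auto simp: h_def h0_def RL_integral_def)
  have h: "continuous_on {a..b} h"
    using continuous_on_frac_int[OF _ _ ab f, of "1 - \<alpha>"] \<alpha> f by (cases "\<alpha> = 1") (auto simp: h_def)
  have eq: "real_of_int \<lceil>real n + \<alpha>\<rceil> - (real n + \<alpha>) = 1 - \<alpha>" "nat \<lceil>real n + \<alpha>\<rceil> = Suc n"
    by (simp_all add: ceiling_add_unit_interval[OF \<alpha>])
  have weak: "has_weak_deriv (Suc n) a b h0 g"
    using RL unfolding is_RL_deriv_def eq h0_def .
  \<comment> \<open>Weak derivatives integrate over the open interval; the end points do not matter
    for the value.\<close>
  have int_eq: "bochner_integral (lebesgue_on {a<..<b}) (\<lambda>t. k t *\<^sub>R u t) = integral {a..b} (\<lambda>t. k t *\<^sub>R u t)"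
    if k: "continuous_on {a..b} k" and u: "continuous_on {a..b} u" for k and u :: "real \<Rightarrow> 'a"
  proof -
    have "set_integrable lebesgue {a<..<b} k"
      by (rule set_integrable_subset[OF absolutely_integrable_continuous_real[OF k]]) auto
    then have "integrable (lebesgue_on {a<..<b}) k"
      by (simp add: set_integrable_def integrable_restrict_space)
    moreover have "{a<..<b} \<in> sets lebesgue" "{a<..<b} \<subseteq> {a..b}" by auto
    ultimately show ?thesis
      using integral_unique[OF bochner_integral_scaleR_continuous[OF _ _ ab _ u]]
      by (simp add: integral_open_interval_real)
  qed
  have "integral {a..b} (\<lambda>t. (deriv ^^ Suc n) \<phi> t *\<^sub>R h t) = (-1) ^ Suc n *\<^sub>R integral {a..b} (\<lambda>t. \<phi> t *\<^sub>R g t)"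
    if \<phi>: "\<phi> \<in> test_functions a b" for \<phi>
  proof -
    have c: "continuous_on {a..b} ((deriv ^^ k) \<phi>)" for k by (rule test_function_continuous[OF \<phi>])
    have "continuous_on {a..b} h0" using h by (rule continuous_on_eq) (simp add: h0)
    then have "integral {a..b} (\<lambda>t. (deriv ^^ Suc n) \<phi> t *\<^sub>R h0 t) = (-1) ^ Suc n *\<^sub>R integral {a..b} (\<lambda>t. \<phi> t *\<^sub>R g t)"
      using weak \<phi> int_eq[OF c[of "Suc n"], of h0] int_eq[OF c[of 0] g] unfolding has_weak_deriv_def by auto
    moreover have "integral {a..b} (\<lambda>t. (deriv ^^ Suc n) \<phi> t *\<^sub>R h0 t) = integral {a..b} (\<lambda>t. (deriv ^^ Suc n) \<phi> t *\<^sub>R h t)"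
      by (rule integral_cong) (simp only: h0)
    ultimately show ?thesis by simp
  qed
  from weak_derivative_classical[OF ab h g this] obtain G where "G (Suc n) = g" "\<And>t. t \<in> {a..b} \<Longrightarrow> G 0 t = h t"
    "\<And>i t. i < Suc n \<Longrightarrow> t \<in> {a..b} \<Longrightarrow> (G i has_vector_derivative G (Suc i) t) (at t within {a..b})"
    by blast
  then show thesis by (intro that[of G]) (auto simp: h_def)
qed

text \<open>K is K a plus J^1 w, and J^\<alpha> commutes with J^1 by the semigroup law. This
  isolates the power (t - a)^\<alpha> with coefficient K a from a continuously differentiable
  remainder.\<close>

lemma frac_int_of_antiderivative:
  fixes K w :: "real \<Rightarrow> 'a::banach"
  assumes ab: "a < b" and \<alpha>: "0 < \<alpha>" "\<alpha> \<le> 1" and w: "continuous_on {a..b} w"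
    and K: "\<And>t. t \<in> {a..b} \<Longrightarrow> (K has_vector_derivative w t) (at t within {a..b})" and t: "t \<in> {a..b}"
  shows "frac_int a \<alpha> K t = ((t - a) powr \<alpha> / Gamma (\<alpha> + 1)) *\<^sub>R K a + integral {a..t} (frac_int a \<alpha> w)"
proof -
  have at: "a \<le> t" using t by simp
  have Kc: "continuous_on {a..b} K" using K by (rule continuous_on_vector_derivative)
  have K_eq: "K s = K a + frac_int a 1 w s" if s: "s \<in> {a..t}" for s
  proof -
    have "(w has_integral K s - K a) {a..s}"
      using s t by (intro fundamental_theorem_of_calculus has_vector_derivative_within_subset[OF K]) auto
    then show ?thesis using s by (simp add: frac_int_1 integral_unique)
  qed
  have int: "(\<lambda>s. (t - s) powr (\<alpha> - 1) *\<^sub>R u s) integrable_on {a..t}" if "continuous_on {a..b} u" for u :: "real \<Rightarrow> 'a"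
    by (rule integrable_kernel_continuous[OF \<alpha>(1) ab t that])
  have "frac_int a \<alpha> K t - frac_int a \<alpha> (frac_int a 1 w) t = frac_int a \<alpha> (\<lambda>s. K s - frac_int a 1 w s) t"
    by (intro frac_int_diff[symmetric] int Kc continuous_on_frac_int ab w) auto
  also have "\<dots> = frac_int a \<alpha> (\<lambda>s. K a) t"
    by (rule frac_int_cong, drule K_eq) simp
  also have "\<dots> = (1 / Gamma \<alpha>) *\<^sub>R ((t - a) powr \<alpha> / \<alpha>) *\<^sub>R K a"
    unfolding frac_int_def
    by (subst integral_unique[OF has_integral_scaleR_left[OF has_integral_kernel[OF \<alpha>(1) at]]]) simp
  also have "\<dots> = ((t - a) powr \<alpha> / Gamma (\<alpha> + 1)) *\<^sub>R K a"
  proof -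
    have "Gamma (\<alpha> + 1) = \<alpha> * Gamma \<alpha>"
      by (subst Gamma_plus1, use \<alpha> in \<open>auto elim!: nonpos_Ints_cases\<close>)
    then show ?thesis by (simp add: mult.commute)
  qed
  finally have 1: "frac_int a \<alpha> K t - frac_int a \<alpha> (frac_int a 1 w) t = ((t - a) powr \<alpha> / Gamma (\<alpha> + 1)) *\<^sub>R K a" .
  have "frac_int a \<alpha> (frac_int a 1 w) t = frac_int a (\<alpha> + 1) w t"
    by (rule frac_int_semigroup[OF \<alpha>(1) _ _ ab w t]) auto
  also have "\<dots> = frac_int a 1 (frac_int a \<alpha> w) t"
    using frac_int_semigroup[OF _ \<alpha> ab w t, of 1] by (simp add: add.commute)
  also have "\<dots> = integral {a..t} (frac_int a \<alpha> w)" by (rule frac_int_1[OF at])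
  finally show ?thesis using 1 by (simp add: algebra_simps)
qed

text \<open>The difference quotient at a is (y - a)^(\<alpha> - 1) c, which is bounded only if c =
  0; multiplied out, norm c is at most a constant times (y - a)^(1 - \<alpha>), which tends to
  0.\<close>

lemma powr_scaleR_not_differentiable:
  fixes c :: "'a::real_normed_vector"
  assumes ab: "a < b" and \<alpha>: "0 < \<alpha>" "\<alpha> < 1"
    and D: "((\<lambda>t. (t - a) powr \<alpha> *\<^sub>R c) has_vector_derivative D) (at a within {a..b})"
  shows "c = 0"
proof -
  obtain d where d: "d > 0" "\<And>y. y \<in> {a..b} \<Longrightarrow> \<bar>y - a\<bar> < d \<Longrightarrow>
      norm ((y - a) powr \<alpha> *\<^sub>R c - (y - a) *\<^sub>R D) \<le> \<bar>y - a\<bar>"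
    using D unfolding has_vector_derivative_def has_derivative_within_alt
    by (auto dest!: spec[of _ "1::real"])
  have bound: "norm c \<le> (1 + norm D) * (y - a) powr (1 - \<alpha>)" if y: "y \<in> {a<..<min b (a + d)}" for y
  proof -
    have "(y - a) powr \<alpha> * norm c \<le> norm ((y - a) powr \<alpha> *\<^sub>R c - (y - a) *\<^sub>R D) + norm ((y - a) *\<^sub>R D)"
      using norm_triangle_sub[of "(y - a) powr \<alpha> *\<^sub>R c" "(y - a) *\<^sub>R D"] by simp
    also have "\<dots> \<le> (y - a) + (y - a) * norm D"
      using d(2)[of y] y by (intro add_mono) auto
    also have "\<dots> = (1 + norm D) * ((y - a) powr \<alpha> * (y - a) powr (1 - \<alpha>))"
      using y by (simp add: algebra_simps flip: powr_add)
    also have "\<dots> = (y - a) powr \<alpha> * ((1 + norm D) * (y - a) powr (1 - \<alpha>))"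
      by (simp only: mult_ac)
    finally show ?thesis using y by simp
  qed
  have "((\<lambda>y. (1 + norm D) * (y - a) powr (1 - \<alpha>)) \<longlongrightarrow> (1 + norm D) * (a - a) powr (1 - \<alpha>)) (at_right a)"
    using \<alpha> by (intro tendsto_intros tendsto_powr') (auto simp: eventually_at_filter)
  moreover have "\<forall>\<^sub>F y in at_right a. norm c \<le> (1 + norm D) * (y - a) powr (1 - \<alpha>)"
    using ab d(1) by (intro eventually_at_rightI[of a "min b (a + d)"] bound) auto
  ultimately have "norm c \<le> (1 + norm D) * (a - a) powr (1 - \<alpha>)"
    by (intro tendsto_lowerbound) auto
  then show ?thesis by simp
qed

lemma eq_if_integrals_eq:
  fixes u v :: "real \<Rightarrow> 'a::banach"
  assumes ab: "a < b" and u: "continuous_on {a..b} u" and v: "continuous_on {a..b} v"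
    and eq: "\<And>t. t \<in> {a..b} \<Longrightarrow> integral {a..t} u = integral {a..t} v" and t: "t \<in> {a..b}"
  shows "u t = v t"
proof -
  have "((\<lambda>t. integral {a..t} u) has_vector_derivative v t) (at t within {a..b})"
    by (rule has_vector_derivative_transform[of t _ _ "\<lambda>t. integral {a..t} v"])
      (use t eq integral_has_vector_derivative[OF v t] in auto)
  with integral_has_vector_derivative[OF u t] show ?thesis
    using vector_derivative_unique_within_closed_interval[OF ab] t by auto
qed

text \<open>Each derivative of f up to order n - 1 is (t - a)^\<alpha> times a multiple of a value
  of the chain at a, plus a differentiable term. As f is n times differentiable at a, that value
  must be 0, and differentiating the rest gives the next order.\<close>

lemma RL_nderiv_eq_frac_int:
  fixes f g :: "real \<Rightarrow> 'a::banach"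
  assumes ab: "a < b" and \<alpha>: "0 < \<alpha>" "\<alpha> < 1" and f: "f \<in> Ck_space n a b"
    and G0: "\<And>t. t \<in> {a..b} \<Longrightarrow> G 0 t = frac_int a (1 - \<alpha>) f t"
    and G: "\<And>i t. i < Suc n \<Longrightarrow> t \<in> {a..b} \<Longrightarrow> (G i has_vector_derivative G (Suc i) t) (at t within {a..b})"
    and g: "continuous_on {a..b} (G (Suc n))"
  shows "i \<le> n \<Longrightarrow> t \<in> {a..b} \<Longrightarrow> nderiv a b i f t = frac_int a \<alpha> (G (Suc i)) t"
proof (induction i arbitrary: t)
  case 0
  have fc: "continuous_on {a..b} f" using nderiv_continuous_on[OF f, of 0] by simp
  have Gc: "continuous_on {a..b} (G (Suc 0))"
  proof (cases "n = 0")
    case False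
    then show ?thesis by (intro continuous_on_vector_derivative[OF G]) auto
  qed (use g in simp)
  have "f t = frac_int a \<alpha> (G (Suc 0)) t"
  proof (rule eq_if_integrals_eq[OF ab fc _ _ 0(2)])
    show "continuous_on {a..b} (frac_int a \<alpha> (G (Suc 0)))"
      using \<alpha> by (intro continuous_on_frac_int ab Gc) auto
    fix t assume t: "t \<in> {a..b}"
    have "integral {a..t} f = frac_int a (\<alpha> + (1 - \<alpha>)) f t" using t by (simp add: frac_int_1)
    also have "\<dots> = frac_int a \<alpha> (frac_int a (1 - \<alpha>) f) t"
      by (rule frac_int_semigroup[OF _ _ _ ab fc t, symmetric]) (use \<alpha> in auto)
    also have "\<dots> = frac_int a \<alpha> (G 0) t" using t by (intro frac_int_cong) (simp add: G0)
    \<comment> \<open>No power term arises here: G 0 a is a fractional integral over a degenerate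
      interval, hence 0.\<close>
    also have "\<dots> = integral {a..t} (frac_int a \<alpha> (G (Suc 0)))"
      using frac_int_of_antiderivative[OF ab \<alpha>(1) _ Gc G t] \<alpha> G0[of a] ab by simp
    finally show "integral {a..t} f = integral {a..t} (frac_int a \<alpha> (G (Suc 0)))" .
  qed
  then show ?case by simp
next
  case (Suc i)
  have Gc: "continuous_on {a..b} (G (Suc (Suc i)))"
  proof (cases "Suc i = n")
    case False
    then show ?thesis using Suc.prems by (intro continuous_on_vector_derivative[OF G]) auto
  qed (use g in simp)
  define w where "w = frac_int a \<alpha> (G (Suc (Suc i)))"
  have wc: "continuous_on {a..b} w"
    unfolding w_def using \<alpha> by (intro continuous_on_frac_int ab Gc) auto
  define c where "c = (1 / Gamma (\<alpha> + 1)) *\<^sub>R G (Suc i) a"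
  have eq: "nderiv a b i f t = (t - a) powr \<alpha> *\<^sub>R c + integral {a..t} w" if t: "t \<in> {a..b}" for t
    unfolding c_def w_def
    using Suc.IH[OF _ t] frac_int_of_antiderivative[OF ab \<alpha>(1) _ Gc G t] \<alpha> Suc.prems by simp
  have nd: "(nderiv a b i f has_vector_derivative nderiv a b (Suc i) f t) (at t within {a..b})" if "t \<in> {a..b}" for t
    using nderiv_has_vector_derivative[OF f _ that] Suc.prems by simp
  have a: "a \<in> {a..b}" using ab by simp
  \<comment> \<open>i < n makes the minuend differentiable at a, so the power term inherits
    differentiability there.\<close>
  have "((\<lambda>t. nderiv a b i f t - integral {a..t} w) has_vector_derivative nderiv a b (Suc i) f a - w a) (at a within {a..b})"
    by (intro has_vector_derivative_diff nd integral_has_vector_derivative wc a)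
  then have "((\<lambda>t. (t - a) powr \<alpha> *\<^sub>R c) has_vector_derivative nderiv a b (Suc i) f a - w a) (at a within {a..b})"
    by (rule has_vector_derivative_transform[OF a, rotated]) (simp add: eq)
  then have "c = 0" by (rule powr_scaleR_not_differentiable[OF ab \<alpha>])
  then have "nderiv a b i f t = integral {a..t} w" if "t \<in> {a..b}" for t
    using eq[OF that] by simp
  then have "(nderiv a b i f has_vector_derivative w t) (at t within {a..b})"
    using Suc.prems(2) integral_has_vector_derivative[OF wc Suc.prems(2)]
    by (intro has_vector_derivative_transform[of t "{a..b}" "nderiv a b i f" "\<lambda>t. integral {a..t} w"]) auto
  with nd[OF Suc.prems(2)] show ?case
    using vector_derivative_unique_within_closed_interval[OF ab] Suc.prems(2) unfolding w_def by auto
qed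

text \<open>Differences cover both cases: for \<alpha> = 1 the n-th derivative is J^1 g plus an
  arbitrary initial value, for \<alpha> < 1 it is J^\<alpha> g itself.\<close>

lemma RL_nderiv_difference:
  fixes f g :: "real \<Rightarrow> 'a::banach"
  assumes ab: "a < b" and \<alpha>: "0 < \<alpha>" "\<alpha> \<le> 1" and f: "f \<in> Ck_space n a b"
    and g: "continuous_on {a..b} g" and RL: "is_RL_deriv a b (real n + \<alpha>) f g"
  shows "s \<in> {a..b} \<Longrightarrow> t \<in> {a..b} \<Longrightarrow> nderiv a b n f t - nderiv a b n f s = frac_int a \<alpha> g t - frac_int a \<alpha> g s"
    and "\<alpha> < 1 \<Longrightarrow> i \<le> n \<Longrightarrow> nderiv a b i f a = 0"
proof -
  have fc: "continuous_on {a..b} f" using nderiv_continuous_on[OF f, of 0] by simp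
  obtain G where G: "G (Suc n) = g"
    "\<And>t. t \<in> {a..b} \<Longrightarrow> G 0 t = (if \<alpha> = 1 then f t else frac_int a (1 - \<alpha>) f t)"
    "\<And>i t. i < Suc n \<Longrightarrow> t \<in> {a..b} \<Longrightarrow> (G i has_vector_derivative G (Suc i) t) (at t within {a..b})"
    using RL_deriv_chain[OF ab \<alpha> fc g RL] by blast
  have lt: "nderiv a b i f t = frac_int a \<alpha> (G (Suc i)) t" if "\<alpha> < 1" "i \<le> n" "t \<in> {a..b}" for i t
    using that G g by (intro RL_nderiv_eq_frac_int[OF ab \<alpha>(1) that(1) f]) auto
  show "nderiv a b i f a = 0" if "\<alpha> < 1" "i \<le> n"
    using lt[OF that, of a] ab by simp
  show "nderiv a b n f t - nderiv a b n f s = frac_int a \<alpha> g t - frac_int a \<alpha> g s"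
    if st: "s \<in> {a..b}" "t \<in> {a..b}"
  proof (cases "\<alpha> = 1")
    case True
    \<comment> \<open>With \<alpha> = 1 the chain starts at f, so its members are the classical
      derivatives of f.\<close>
    have eq: "nderiv a b n f t = G n t" if "t \<in> {a..b}" for t
      using G that True by (intro nderiv_eq_chain[where F=G and k="Suc n", OF ab]) auto
    have Gn: "G n t - G n a = frac_int a 1 g t" if t: "t \<in> {a..b}" for t
    proof -
      have "(g has_integral G n t - G n a) {a..t}"
        using t G by (intro fundamental_theorem_of_calculus has_vector_derivative_within_subset[OF G(3)[of n, unfolded G(1)]]) auto
      then show ?thesis using t by (simp add: frac_int_1 integral_unique)
    qed
    then show ?thesis 
      unfolding eq[OF st(1)] eq[OF st(2)] True Gn[OF st(1), symmetric] Gn[OF st(2), symmetric] by simp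
  next
    case False
    then show ?thesis using lt[of n] st \<alpha> G(1) by simp
  qed
qed

lemma RL_nderiv_Hoelder:
  fixes f g :: "real \<Rightarrow> 'a::banach"
  assumes "a < b" "0 < \<alpha>" "\<alpha> \<le> 1" "f \<in> Ck_space n a b" "continuous_on {a..b} g"
    "is_RL_deriv a b (real n + \<alpha>) f g"
    and "\<And>r. r \<in> {a..b} \<Longrightarrow> norm (g r) \<le> B" "s \<in> {a..b}" "t \<in> {a..b}"
  shows "norm (nderiv a b n f t - nderiv a b n f s) \<le> 2 * B / Gamma (\<alpha> + 1) * \<bar>t - s\<bar> powr \<alpha>"
  unfolding RL_nderiv_difference(1)[OF assms(1-6,8,9)]
  using assms by (intro frac_int_Hoelder) auto

lemma RL_spaceD:
  assumes "f \<in> RL_space (real n + \<alpha>) a b" "0 < \<alpha>" "\<alpha> \<le> 1"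
  shows "f \<in> Ck_space n a b" "continuous_on {a..b} (RL_deriv a b (real n + \<alpha>) f)"
    "is_RL_deriv a b (real n + \<alpha>) f (RL_deriv a b (real n + \<alpha>) f)"
proof -
  let ?P = "\<lambda>g. continuous_on {a..b} g \<and> is_RL_deriv a b (real n + \<alpha>) f g"
  have "f \<in> Ck_space n a b" "\<exists>g. ?P g" 
    using assms(1) by (simp_all only: RL_space_def nat_ceiling_minus_1[OF assms(2,3)] mem_Collect_eq)
  with someI_ex[of ?P] show "f \<in> Ck_space n a b" "continuous_on {a..b} (RL_deriv a b (real n + \<alpha>) f)"
    "is_RL_deriv a b (real n + \<alpha>) f (RL_deriv a b (real n + \<alpha>) f)"
    unfolding RL_deriv_def by blast+
qed

lemma RL_space_subset_Holder_space:
  fixes f :: "real \<Rightarrow> 'a::banach"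
  assumes ab: "a < b" and \<alpha>: "0 < \<alpha>" "\<alpha> \<le> 1" and f: "f \<in> RL_space (real n + \<alpha>) a b"
  shows "f \<in> Holder_space n \<alpha> a b"
proof -
  note D = RL_spaceD[OF f \<alpha>]
  obtain B where B: "\<And>s. s \<in> {a..b} \<Longrightarrow> norm (RL_deriv a b (real n + \<alpha>) f s) \<le> B"
    using continuous_on_Icc_norm_bound[OF D(2)] by blast
  \<comment> \<open>The maximum with 1 meets the demand M > 0 when B is 0.\<close>
  define M where "M = max 1 (2 * B / Gamma (\<alpha> + 1))"
  have "norm (nderiv a b n f t - nderiv a b n f s) \<le> M * \<bar>t - s\<bar> powr \<alpha>" if "s \<in> {a..b}" "t \<in> {a..b}" for s t
  proof -
    have "norm (nderiv a b n f t - nderiv a b n f s) \<le> 2 * B / Gamma (\<alpha> + 1) * \<bar>t - s\<bar> powr \<alpha>"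
      by (rule RL_nderiv_Hoelder[OF ab \<alpha> D _ that]) (rule B)
    also have "\<dots> \<le> M * \<bar>t - s\<bar> powr \<alpha>"
      by (rule mult_right_mono) (simp_all add: M_def)
    finally show ?thesis .
  qed
  moreover have "M > 0" by (simp add: M_def)
  ultimately show ?thesis using D(1) by (auto simp: Holder_space_def)
qed

text \<open>The C^n norm occurs in both norms, and the Hoelder seminorm is at most 2 / Gamma
  (\<alpha> + 1) times the sup norm of the fractional derivative; the constant does not depend on
  the interval.\<close>

lemma Holder_norm_le_RL_norm:
  fixes f :: "real \<Rightarrow> 'a::banach"
  assumes ab: "a < b" and \<alpha>: "0 < \<alpha>" "\<alpha> \<le> 1" and f: "f \<in> RL_space (real n + \<alpha>) a b"
  shows "Holder_norm n \<alpha> a b f \<le> (1 + 2 / Gamma (\<alpha> + 1)) * RL_norm (real n + \<alpha>) a b f"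
proof -
  note D = RL_spaceD[OF f \<alpha>]
  define g where "g = RL_deriv a b (real n + \<alpha>) f"
  define B where "B = (SUP t\<in>{a..b}. norm (g t))"
  obtain C where C: "\<And>s. s \<in> {a..b} \<Longrightarrow> norm (g s) \<le> C"
    using continuous_on_Icc_norm_bound[OF D(2)] unfolding g_def by blast
  have B: "norm (g s) \<le> B" if "s \<in> {a..b}" for s
    unfolding B_def using that C by (intro cSUP_upper bdd_aboveI2[of _ _ C]) auto
  have B0: "B \<ge> 0" using order_trans[OF norm_ge_zero B[of a]] ab by simp
  define k where "k = 2 / Gamma (\<alpha> + 1)"
  have k: "k \<ge> 0" using \<alpha> unfolding k_def by (intro divide_nonneg_nonneg less_imp_le) auto
  let ?S = "{(t, s). t \<in> {a..b} \<and> s \<in> {a..b} \<and> t \<noteq> s}"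
  have "(SUP (t, s)\<in>?S. norm (nderiv a b n f t - nderiv a b n f s) / \<bar>t - s\<bar> powr \<alpha>) \<le> 2 * B / Gamma (\<alpha> + 1)"
  proof (rule cSUP_least)
    have "(a, b) \<in> ?S" using ab by simp
    then show "?S \<noteq> {}" by blast
    fix p assume "p \<in> ?S"
    then obtain t s where p: "p = (t, s)" "t \<in> {a..b}" "s \<in> {a..b}" "t \<noteq> s" by auto
    have "norm (nderiv a b n f t - nderiv a b n f s) \<le> 2 * B / Gamma (\<alpha> + 1) * \<bar>t - s\<bar> powr \<alpha>"
      by (rule RL_nderiv_Hoelder[OF ab \<alpha> D _ p(3,2)]) (use B in \<open>simp add: g_def\<close>)
    then show "(case p of (t, s) \<Rightarrow> norm (nderiv a b n f t - nderiv a b n f s) / \<bar>t - s\<bar> powr \<alpha>) \<le> 2 * B / Gamma (\<alpha> + 1)"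
      using p by (simp add: pos_divide_le_eq)
  qed
  then have "Holder_norm n \<alpha> a b f \<le> Ck_norm n a b f + k * B"
    by (simp add: Holder_norm_def k_def)
  also have "\<dots> \<le> (1 + k) * (Ck_norm n a b f + B)"
    using B0 mult_nonneg_nonneg[OF k Ck_norm_nonneg[OF D(1) ab]] by (simp add: algebra_simps)
  also have "Ck_norm n a b f + B = RL_norm (real n + \<alpha>) a b f"
    unfolding RL_norm_def nat_ceiling_minus_1[OF \<alpha>] by (simp add: Ck_norm_def B_def g_def)
  finally show ?thesis unfolding k_def .
qed

section \<open>Truncated powers and strictness of the inclusion\<close>

lemma powr_subadditive:
  fixes x y \<alpha> :: real
  assumes "0 \<le> y" "y \<le> x" "0 < \<alpha>" "\<alpha> \<le> 1"
  shows "x powr \<alpha> - y powr \<alpha> \<le> (x - y) powr \<alpha>"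
proof (cases "x = 0")
  case False
  then have x: "x > 0" using assms by simp
  have le: "u \<le> u powr \<alpha>" if "0 \<le> u" "u \<le> 1" for u :: real
  proof (cases "u = 0")
    case False
    then show ?thesis using powr_mono'[of \<alpha> 1 u] that assms by simp
  qed simp
  \<comment> \<open>Numbers in [0, 1] grow when raised to \<alpha> \<le> 1; applied to y/x and 1 -
    y/x this is the claim divided by x^\<alpha>.\<close>
  have "1 = y / x + (1 - y / x)" by simp
  also have "\<dots> \<le> (y / x) powr \<alpha> + (1 - y / x) powr \<alpha>"
    using assms x by (intro add_mono le) auto
  finally have "x powr \<alpha> * 1 \<le> x powr \<alpha> * ((y / x) powr \<alpha> + (1 - y / x) powr \<alpha>)"
    by (intro mult_left_mono) auto
  also have "\<dots> = (x * (y / x)) powr \<alpha> + (x * (1 - y / x)) powr \<alpha>"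
    by (simp only: powr_mult distrib_left)
  finally show ?thesis using x by (simp add: right_diff_distrib)
qed (use assms in simp)

lemma max_powr_Hoelder:
  fixes s t c \<alpha> :: real
  assumes "0 < \<alpha>" "\<alpha> \<le> 1"
  shows "\<bar>max 0 (t - c) powr \<alpha> - max 0 (s - c) powr \<alpha>\<bar> \<le> \<bar>t - s\<bar> powr \<alpha>"
proof -
  have *: "\<bar>max 0 (t - c) powr \<alpha> - max 0 (s - c) powr \<alpha>\<bar> \<le> \<bar>t - s\<bar> powr \<alpha>" if "s \<le> t" for s t
  proof -
    have "max 0 (s - c) powr \<alpha> \<le> max 0 (t - c) powr \<alpha>"
      using that assms by (intro powr_mono2) auto
    moreover have "max 0 (t - c) powr \<alpha> - max 0 (s - c) powr \<alpha> \<le> (max 0 (t - c) - max 0 (s - c)) powr \<alpha>"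
      using that assms by (intro powr_subadditive) auto
    moreover have "(max 0 (t - c) - max 0 (s - c)) powr \<alpha> \<le> (t - s) powr \<alpha>"
      using that assms by (intro powr_mono2) auto
    ultimately show ?thesis using that by simp
  qed
  show ?thesis using *[of s t] *[of t s] by (cases "s \<le> t") (auto simp: abs_minus_commute)
qed

text \<open>At the junction c the difference quotient is at most |h|^(p - 1), which tends to 0
  because p > 1.\<close>

lemma has_real_derivative_max_powr:
  fixes p c t :: real
  assumes p: "p > 1"
  shows "((\<lambda>t. max 0 (t - c) powr p) has_real_derivative p * max 0 (t - c) powr (p - 1)) (at t)"
proof -
  consider "t > c" | "t < c" | "t = c" by linarith
  then show ?thesis
  proof cases
    case 1
    then have "((\<lambda>t. (t - c) powr p) has_real_derivative p * (t - c) powr (p - 1)) (at t)"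
      by (auto intro!: derivative_eq_intros)
    then have "((\<lambda>t. max 0 (t - c) powr p) has_real_derivative p * (t - c) powr (p - 1)) (at t)"
      by (rule has_field_derivative_transform_within_open[of _ _ _ "{c<..}"]) (use 1 in auto)
    then show ?thesis using 1 by simp
  next
    case 2
    have "((\<lambda>t. 0) has_real_derivative 0) (at t)" by simp
    then have "((\<lambda>t. max 0 (t - c) powr p) has_real_derivative 0) (at t)"
      by (rule has_field_derivative_transform_within_open[of _ _ _ "{..<c}"]) (use 2 in auto)
    then show ?thesis using 2 by simp
  next
    case 3
    have "((\<lambda>h. max 0 h powr p / h) \<longlongrightarrow> 0) (at 0)"
    proof (rule Lim_null_comparison)
      have "norm (max 0 h powr p / h) \<le> \<bar>h\<bar> powr (p - 1)" if "h \<noteq> 0" for h :: real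
      proof (cases "h > 0")
        case False
        then have "max 0 h = 0" by simp
        then show ?thesis by simp
      qed (simp add: powr_diff)
      then show "\<forall>\<^sub>F h in at 0. norm (max 0 h powr p / h) \<le> \<bar>h\<bar> powr (p - 1)"
        by (auto simp: eventually_at_filter)
      have "((\<lambda>h::real. \<bar>h\<bar> powr (p - 1)) \<longlongrightarrow> \<bar>0\<bar> powr (p - 1)) (at 0)"
        using p by (intro tendsto_intros tendsto_powr') auto
      then show "((\<lambda>h::real. \<bar>h\<bar> powr (p - 1)) \<longlongrightarrow> 0) (at 0)" by simp
    qed
    then show ?thesis using 3 by (simp add: DERIV_def)
  qed
qed

text \<open>With this normalisation differentiation lowers p by 1 and fractional integration raises
  it by its order, without further factors. For c \<ge> a and p > 0 it is J^p, started at a, of the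
  indicator of (c, infinity) times x.\<close>

definition trunc_power :: "real \<Rightarrow> 'a::banach \<Rightarrow> real \<Rightarrow> real \<Rightarrow> 'a" where
  "trunc_power c x p t = (1 / Gamma (p + 1) * max 0 (t - c) powr p) *\<^sub>R x"

lemma trunc_power_has_vector_derivative:
  assumes p: "p > 1"
  shows "(trunc_power c x p has_vector_derivative trunc_power c x (p - 1) t) (at t within S)"
proof -
  have "Gamma (p + 1) = p * Gamma p"
    by (subst Gamma_plus1, use p in \<open>auto elim!: nonpos_Ints_cases\<close>)
  then have eq: "1 / Gamma (p + 1) * (p * m) = 1 / Gamma (p - 1 + 1) * m" for m using p by simp
  have "((\<lambda>t. 1 / Gamma (p + 1) * max 0 (t - c) powr p) has_real_derivative
      1 / Gamma (p + 1) * (p * max 0 (t - c) powr (p - 1))) (at t within S)"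
    by (intro DERIV_cmult has_field_derivative_at_within[OF has_real_derivative_max_powr[OF p]])
  then have "((\<lambda>t. 1 / Gamma (p + 1) * max 0 (t - c) powr p) has_vector_derivative
      1 / Gamma (p - 1 + 1) * max 0 (t - c) powr (p - 1)) (at t within S)"
    unfolding eq by (simp only: has_real_derivative_iff_has_vector_derivative)
  from bounded_linear.has_vector_derivative[OF bounded_linear_scaleR_left[of x] this]
  show ?thesis by (simp add: trunc_power_def[abs_def])
qed

lemma trunc_power_at_start: "a < c \<Longrightarrow> trunc_power c x p a = 0"
  by (simp add: trunc_power_def)

lemma nderiv_trunc_power:
  assumes ab: "a < b" and q: "q > real n" and i: "i \<le> n" and t: "t \<in> {a..b}"
    and f: "\<And>t. t \<in> {a..b} \<Longrightarrow> f t = trunc_power c x q t"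
  shows "nderiv a b i f t = trunc_power c x (q - real i) t"
proof (rule nderiv_eq_chain[where F="\<lambda>i. trunc_power c x (q - real i)", OF ab _ _ i t])
  fix i t assume "i < n" "t \<in> {a..b}"
  then have "q - real i > 1" using q by linarith
  from trunc_power_has_vector_derivative[OF this]
  show "(trunc_power c x (q - real i) has_vector_derivative trunc_power c x (q - real (Suc i)) t) (at t within {a..b})"
    by (simp add: algebra_simps)
qed (use f in simp)

text \<open>The n-th derivative is the truncated power of exponent \<alpha>, which is globally
  \<alpha>-Hoelder; all derivatives vanish at a since the function is 0 up to c.\<close>

lemma trunc_power_in_Holder0_space:
  fixes x :: "'a::banach"
  assumes ab: "a < c" "c < b" and \<alpha>: "0 < \<alpha>" "\<alpha> \<le> 1"
  shows "trunc_power c x (real n + \<alpha>) \<in> Holder0_space n \<alpha> a b"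
proof -
  have ab': "a < b" using ab by simp
  let ?q = "real n + \<alpha>"
  have nd: "nderiv a b i (trunc_power c x ?q) t = trunc_power c x (?q - real i) t" if "i \<le> n" "t \<in> {a..b}" for i t
    using that \<alpha> by (intro nderiv_trunc_power[OF ab', of n]) auto
  define C where "C = norm x / Gamma (\<alpha> + 1)"
  have Hoelder: "norm (trunc_power c x \<alpha> t - trunc_power c x \<alpha> s) \<le> C * \<bar>t - s\<bar> powr \<alpha>" for s t
  proof -
    have "norm (trunc_power c x \<alpha> t - trunc_power c x \<alpha> s)
        = C * \<bar>max 0 (t - c) powr \<alpha> - max 0 (s - c) powr \<alpha>\<bar>"
    proof -
      have G: "Gamma (\<alpha> + 1) > 0" using \<alpha> by simp
      have "trunc_power c x \<alpha> t - trunc_power c x \<alpha> s = (1 / Gamma (\<alpha> + 1) * (max 0 (t - c) powr \<alpha> - max 0 (s - c) powr \<alpha>)) *\<^sub>R x"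
        unfolding trunc_power_def by (simp only: scaleR_diff_left right_diff_distrib)
      then show ?thesis using G by (simp add: C_def abs_mult)
    qed
    also have "\<dots> \<le> C * \<bar>t - s\<bar> powr \<alpha>"
      using \<alpha> by (intro mult_left_mono max_powr_Hoelder) (auto simp: C_def intro!: divide_nonneg_nonneg less_imp_le)
    finally show ?thesis .
  qed
  have cont: "continuous_on {a..b} (trunc_power c x \<alpha>)"
    using continuous_on_Hoelder[OF \<alpha>(1) Hoelder] by blast
  have Ck: "trunc_power c x ?q \<in> Ck_space n a b"
  proof (rule Ck_spaceI_chain[where F="\<lambda>i. trunc_power c x (?q - real i)", OF ab'])
    fix i t assume "i < n" "t \<in> {a..b}"
    then have "?q - real i > 1" using \<alpha> by linarith
    from trunc_power_has_vector_derivative[OF this]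
    show "(trunc_power c x (?q - real i) has_vector_derivative trunc_power c x (?q - real (Suc i)) t) (at t within {a..b})"
      by (simp add: algebra_simps)
  qed (use cont in auto)
  have "norm (nderiv a b n (trunc_power c x ?q) t - nderiv a b n (trunc_power c x ?q) s) \<le> max 1 C * \<bar>t - s\<bar> powr \<alpha>"
    if "s \<in> {a..b}" "t \<in> {a..b}" for s t
    using nd[of n] that order_trans[OF Hoelder[of t s] mult_right_mono[of C "max 1 C" "\<bar>t - s\<bar> powr \<alpha>"]] by simp
  moreover have "max 1 C > 0" by simp
  moreover have "nderiv a b i (trunc_power c x ?q) a = 0" if "i \<le> n" for i
    using nd[OF that, of a] ab by (simp add: trunc_power_at_start)
  ultimately show ?thesis
    using Ck unfolding Holder0_space_def Holder_space_def by blast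
qed

text \<open>Integration of order 1 - \<alpha> gives the exponent n + 1, and n derivatives leave max
  0 (t - c) times x. Membership would make this differentiable at c, but its one-sided derivatives
  are 0 and x.\<close>

lemma trunc_power_notin_RL_space:
  fixes x :: "'a::banach"
  assumes ab: "a < c" "c < b" and \<alpha>: "0 < \<alpha>" "\<alpha> \<le> 1" and x: "x \<noteq> 0"
  shows "trunc_power c x (real n + \<alpha>) \<notin> RL_space (real n + \<alpha>) a b"
proof
  let ?f = "trunc_power c x (real n + \<alpha>)"
  assume "?f \<in> RL_space (real n + \<alpha>) a b"
  note D = RL_spaceD[OF this \<alpha>]
  have ab': "a < b" using ab by simp
  have fc: "continuous_on {a..b} ?f" using nderiv_continuous_on[OF D(1), of 0] by simp
  obtain G where "G (Suc n) = RL_deriv a b (real n + \<alpha>) ?f"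
    and G: "\<And>t. t \<in> {a..b} \<Longrightarrow> G 0 t = (if \<alpha> = 1 then ?f t else frac_int a (1 - \<alpha>) ?f t)"
    "\<And>i t. i < Suc n \<Longrightarrow> t \<in> {a..b} \<Longrightarrow> (G i has_vector_derivative G (Suc i) t) (at t within {a..b})"
  proof (rule RL_deriv_chain[OF ab' \<alpha> fc D(2,3)])
    fix G assume "G (Suc n) = RL_deriv a b (real n + \<alpha>) ?f"
      "\<And>t. t \<in> {a..b} \<Longrightarrow> G 0 t = (if \<alpha> = 1 then ?f t else frac_int a (1 - \<alpha>) ?f t)"
      "\<And>i t. i < Suc n \<Longrightarrow> t \<in> {a..b} \<Longrightarrow> (G i has_vector_derivative G (Suc i) t) (at t within {a..b})"
    then show thesis by (rule that[of G])
  qed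
  have G0: "G 0 t = trunc_power c x (real (Suc n)) t" if t: "t \<in> {a..b}" for t
  proof (cases "\<alpha> = 1")
    case False
    have "Gamma (real n + \<alpha> + 1) > 0" using \<alpha> by simp
    then have nz: "Gamma (real n + \<alpha> + 1) \<noteq> 0" by linarith
    have "frac_int a (1 - \<alpha>) ?f t = (1 / Gamma (real n + \<alpha> + 1) * (Gamma (real n + \<alpha> + 1) /
      Gamma (real n + \<alpha> + 1 + (1 - \<alpha>))) * max 0 (t - c) powr (real n + \<alpha> + (1 - \<alpha>))) *\<^sub>R x"
      unfolding trunc_power_def[abs_def] using ab \<alpha> False by (intro frac_int_powr) auto
    then show ?thesis using G(1)[OF t] nz False by (simp add: trunc_power_def add_ac)
  qed (use G(1)[OF t] in \<open>simp add: add_ac\<close>)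
  have Gn: "G n t = max 0 (t - c) *\<^sub>R x" if t: "t \<in> {a..b}" for t
  proof -
    have "nderiv a b n (G 0) t = G n t"
      by (rule nderiv_eq_chain[where F=G and k="Suc n", OF ab' _ G(2) _ t]) auto
    moreover have "nderiv a b n (G 0) t = trunc_power c x (real (Suc n) - real n) t"
      by (rule nderiv_trunc_power[OF ab' _ order_refl t G0]) auto
    moreover have "trunc_power c x (real (Suc n) - real n) t = max 0 (t - c) *\<^sub>R x"
      using Gamma_fact[of 1, where ?'a=real] by (simp add: trunc_power_def)
    ultimately show ?thesis by simp
  qed
  have c: "c \<in> {a..b}" using ab by simp
  define D' where "D' = G (Suc n) c"
  have GD: "(G n has_vector_derivative D') (at c within {a..b})"
    using G(2)[of n c] c by (simp add: D'_def)
  \<comment> \<open>The derivative at c is read off on each side separately, and uniqueness on each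
    half interval forces two different values.\<close>
  have "((\<lambda>t. 0) has_vector_derivative D') (at c within {a..c})"
    by (rule has_vector_derivative_transform[OF _ _ has_vector_derivative_within_subset[OF GD]])
      (use ab in \<open>auto simp: Gn\<close>)
  then have "D' = 0"
    using vector_derivative_unique_within_closed_interval[of a c c "\<lambda>t. 0" D' 0] ab by simp
  have "((\<lambda>t. (t - c) *\<^sub>R x) has_vector_derivative D') (at c within {c..b})"
    by (rule has_vector_derivative_transform[OF _ _ has_vector_derivative_within_subset[OF GD]])
      (use ab in \<open>auto simp: Gn\<close>)
  moreover have "((\<lambda>t. (t - c) *\<^sub>R x) has_vector_derivative x) (at c within {c..b})"
    by (auto intro!: derivative_eq_intros)
  ultimately have "D' = x"
    using vector_derivative_unique_within_closed_interval[of c b c "\<lambda>t. (t - c) *\<^sub>R x" D' x] ab by simp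
  with \<open>D' = 0\<close> x show False by simp
qed

text \<open>Over the zero space all these sets coincide, hence the nonzero vector. For \<alpha> = 1
  strictness refers to the part of the RL space with vanishing initial values; the same truncated
  power is the witness in both cases.\<close>

theorem theorem22:
  fixes t0 t1 \<alpha> :: real and n :: nat
  assumes nontrivial: "\<exists>x::'a::banach. x \<noteq> 0"
    and "t0 < t1" and "0 < \<alpha>" and "\<alpha> \<le> 1"
  shows "(\<alpha> < 1 \<longrightarrow>
            (RL_space (real n + \<alpha>) t0 t1 :: (real \<Rightarrow> 'a) set) \<subset> Holder0_space n \<alpha> t0 t1) \<and>
         (\<alpha> = 1 \<longrightarrow>
            (RL_space (real n + \<alpha>) t0 t1 :: (real \<Rightarrow> 'a) set) \<subseteq> Holder_space n \<alpha> t0 t1 \<and>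
            {f \<in> RL_space (real n + \<alpha>) t0 t1. \<forall>i\<le>n. nderiv t0 t1 i f t0 = (0::'a)}
              \<subset> Holder0_space n \<alpha> t0 t1) \<and>
         (\<exists>M>0. \<forall>f\<in>(RL_space (real n + \<alpha>) t0 t1 :: (real \<Rightarrow> 'a) set).
            Holder_norm n \<alpha> t0 t1 f \<le> M * RL_norm (real n + \<alpha>) t0 t1 f)"
proof (intro conjI impI)
  note \<alpha> = assms(3,4)
  obtain x :: 'a where x: "x \<noteq> 0" using nontrivial by blast
  define c where "c = (t0 + t1) / 2"
  have c: "t0 < c" "c < t1" using assms(2) by (simp_all add: c_def)
  let ?RL = "RL_space (real n + \<alpha>) t0 t1 :: (real \<Rightarrow> 'a) set"
  have strict: "trunc_power c x (real n + \<alpha>) \<in> Holder0_space n \<alpha> t0 t1" "trunc_power c x (real n + \<alpha>) \<notin> ?RL"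
    using trunc_power_in_Holder0_space[OF c \<alpha>] trunc_power_notin_RL_space[OF c \<alpha> x] by auto
  show sub: "?RL \<subseteq> Holder_space n \<alpha> t0 t1"
    using RL_space_subset_Holder_space[OF assms(2) \<alpha>] by blast
  show "{f \<in> ?RL. \<forall>i\<le>n. nderiv t0 t1 i f t0 = 0} \<subset> Holder0_space n \<alpha> t0 t1"
    using sub strict unfolding Holder0_space_def by blast
  show "?RL \<subset> Holder0_space n \<alpha> t0 t1" if "\<alpha> < 1"
  proof -
    have "nderiv t0 t1 i f t0 = 0" if "f \<in> ?RL" "i \<le> n" for f i
      using RL_nderiv_difference(2)[OF assms(2) \<alpha> RL_spaceD[OF that(1) \<alpha>] \<open>\<alpha> < 1\<close> that(2)] .
    then show ?thesis using sub strict unfolding Holder0_space_def by blast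
  qed
  have "Gamma (\<alpha> + 1) > 0" using \<alpha> by simp
  then have "1 + 2 / Gamma (\<alpha> + 1) > 0" by (simp add: add_pos_pos)
  then show "\<exists>M>0. \<forall>f\<in>?RL. Holder_norm n \<alpha> t0 t1 f \<le> M * RL_norm (real n + \<alpha>) t0 t1 f"
    using Holder_norm_le_RL_norm[OF assms(2) \<alpha>] by blast
qed

end
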